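(* Let $k$ be a field and let $I$ be a monomial ideal in $R = k[x_1,\ldots,x_r]$ such that $I^{(n)} = (I^n)^{\mathrm{sat}}$ for all $n \ge 1$. Then $\operatorname{isdef}_I(n) = O(n^{r-2})$ as $n\to\infty$.
   Context: Let $\mathfrak m = (x_1,\ldots,x_r)$. For an ideal $I$ of $R$, the $n$-th symbolic power is $I^{(n)} := \bigcap_{\mathfrak p \in \operatorname{Ass}(R/I)} (I^n R_{\mathfrak p} \cap R)$, the intersection being over all associated primes of $R/I$. The saturation of an ideal $K$ is $K^{\mathrm{sat}} = \bigcup_{i\ge 1} (K : \mathfrak m^i)$. $\overline{K}$ denotes the integral closure of an ideal $K$. For a finitely generated graded $R$-module $M$, $\mu(M) = \dim_k(M/\mathfrak m M)$. The integral symbolic defect of $I$ is $\operatorname{isdef}_I(n) := \mu\left(\overline{I^{(n)}}/\overline{I^n}\right)$. For functions $f,g$ of $n$, $f(n)=O(g(n))$ means $\limsup_{n\to\infty} f(n)/g(n) < \infty$. *)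

theory Defs
  imports
    "HOL-Algebra.Ideal_Product"
    "HOL-Algebra.QuotRing"
    "HOL-Algebra.Module"
    "HOL-Algebra.Algebraic_Closure_Type"
    "HOL-Library.Cardinality"
    "HOL-Library.Poly_Mapping"
    "HOL-Library.Extended_Real"
    "HOL-Library.Liminf_Limsup"
    "HOL-Computational_Algebra.Fraction_Field"
begin

text \<open>
  The variables are indexed by a finite linearly ordered type \<open>'n\<close>, so the number of
  variables is \<open>r = CARD('n)\<close>. The order on \<open>'n\<close> only serves to obtain the library's instance
  of class \<^class>\<open>idom\<close> for polynomials, which the type of fractions needs.
\<close>

type_synonym ('n, 'k) mpoly = "('n \<Rightarrow>\<^sub>0 nat) \<Rightarrow>\<^sub>0 'k"

abbreviation mpoly_ring :: "('n, 'k::field) mpoly ring" where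
  "mpoly_ring \<equiv> ring_of_type_algebra"

definition mconst :: "'k::field \<Rightarrow> ('n, 'k) mpoly" where
  "mconst c = Poly_Mapping.single 0 c"

definition monomial :: "('n \<Rightarrow>\<^sub>0 nat) \<Rightarrow> ('n, 'k::field) mpoly" where
  "monomial e = Poly_Mapping.single e 1"

definition mvar :: "'n \<Rightarrow> ('n, 'k::field) mpoly" where
  "mvar i = monomial (Poly_Mapping.single i 1)"

definition max_ideal :: "('n, 'k::field) mpoly set" where
  "max_ideal = Idl\<^bsub>mpoly_ring\<^esub> (range mvar)"

definition monomial_ideal :: "('n, 'k::field) mpoly set \<Rightarrow> bool" where
  "monomial_ideal I \<longleftrightarrow> (\<exists>E. I = Idl\<^bsub>mpoly_ring\<^esub> (monomial ` E))"

abbreviation ideal_power :: "('n, 'k::field) mpoly set \<Rightarrow> nat \<Rightarrow> ('n, 'k) mpoly set" where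
  "ideal_power I n \<equiv> I [^]\<^bsub>ideals_set mpoly_ring\<^esub> n"

definition colon :: "('n, 'k::field) mpoly set \<Rightarrow> ('n, 'k) mpoly set \<Rightarrow> ('n, 'k) mpoly set" where
  "colon K J = {f. \<forall>g\<in>J. f * g \<in> K}"

definition saturation :: "('n, 'k::field) mpoly set \<Rightarrow> ('n, 'k) mpoly set" where
  "saturation K = (\<Union>i\<in>{1..}. colon K (ideal_power max_ideal i))"

definition integral_closure :: "('n, 'k::field) mpoly set \<Rightarrow> ('n, 'k) mpoly set" where
  "integral_closure K =
     {f. \<exists>n\<ge>1. \<exists>a. (\<forall>i\<in>{1..n}. a i \<in> ideal_power K i) \<and>
           f ^ n + (\<Sum>i = 1..n. a i * f ^ (n - i)) = 0}"


text \<open>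
  Records of type \<^type>\<open>module\<close> also carry a multiplication and a unit. They play no role for
  modules; below they are whatever the underlying ring record provides.
\<close>

definition ideal_module ::
  "('n, 'k::field) mpoly set \<Rightarrow> (('n, 'k) mpoly, ('n, 'k) mpoly) module" where
  "ideal_module A = ring.extend (mpoly_ring\<lparr>carrier := A\<rparr>) (module.fields (*))"

text \<open>
  As in \<^const>\<open>FactRing\<close>, the elements of the quotient are the cosets of \<open>N\<close>; the scalar
  multiplication is \<open>a \<odot> (N + x) = N + a \<odot> x\<close>.
\<close>

definition quot_module :: "('a, 'v) module \<Rightarrow> 'v set \<Rightarrow> ('a, 'v set) module" where
  "quot_module M N = ring.extend (M Quot N)
     (module.fields (\<lambda>a S. \<Union>x\<in>S. N +>\<^bsub>M\<^esub> (a \<odot>\<^bsub>M\<^esub> x)))"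

definition ideal_times_module ::
  "('n, 'k::field) mpoly set \<Rightarrow> (('n, 'k) mpoly, 'v) module \<Rightarrow> 'v set" where
  "ideal_times_module J M =
     \<Inter>{N. submodule N mpoly_ring M \<and> (\<forall>a\<in>J. \<forall>x\<in>carrier M. a \<odot>\<^bsub>M\<^esub> x \<in> N)}"

definition k_basis :: "(('n, 'k::field) mpoly, 'v) module \<Rightarrow> 'v set \<Rightarrow> bool" where
  "k_basis V B \<longleftrightarrow> B \<subseteq> carrier V \<and>
     (\<forall>v\<in>carrier V. \<exists>!c :: 'v \<Rightarrow> 'k. finite {b. c b \<noteq> 0} \<and> {b. c b \<noteq> 0} \<subseteq> B \<and>
        v = (\<Oplus>\<^bsub>V\<^esub>b\<in>{b. c b \<noteq> 0}. mconst (c b) \<odot>\<^bsub>V\<^esub> b))"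

definition k_dim :: "(('n, 'k::field) mpoly, 'v) module \<Rightarrow> enat" where
  "k_dim V = (let B = (SOME B. k_basis V B) in if finite B then enat (card B) else \<infinity>)"

definition num_gens :: "(('n, 'k::field) mpoly, 'v) module \<Rightarrow> enat" where
  "num_gens M = k_dim (quot_module M (ideal_times_module max_ideal M))"


definition associated_primes ::
  "(('n, 'k::field) mpoly, 'v) module \<Rightarrow> ('n, 'k) mpoly set set" where
  "associated_primes M =
     {P. primeideal P mpoly_ring \<and> (\<exists>x\<in>carrier M. P = {a. a \<odot>\<^bsub>M\<^esub> x = \<zero>\<^bsub>M\<^esub>})}"

definition to_frac ::
  "('n::{finite, linorder}, 'k::field) mpoly \<Rightarrow> ('n, 'k) mpoly fract" where
  "to_frac f = Fract f 1"

text \<open>For a prime ideal \<open>P\<close>, the localization at \<open>P\<close> as a subring of the field of fractions.\<close>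

definition localization ::
  "('n::{finite, linorder}, 'k::field) mpoly set \<Rightarrow> ('n, 'k) mpoly fract ring" where
  "localization P = ring_of_type_algebra\<lparr>carrier := {Fract f s |f s. s \<notin> P}\<rparr>"

definition symbolic_power ::
  "('n::{finite, linorder}, 'k::field) mpoly set \<Rightarrow> nat \<Rightarrow> ('n, 'k) mpoly set" where
  "symbolic_power I n =
     (\<Inter>P\<in>associated_primes (quot_module (ideal_module UNIV) I).
        {f. to_frac f \<in> Idl\<^bsub>localization P\<^esub> (to_frac ` ideal_power I n)})"

definition isdef ::
  "('n::{finite, linorder}, 'k::field) mpoly set \<Rightarrow> nat \<Rightarrow> enat" where
  "isdef I n = num_gens (quot_module (ideal_module (integral_closure (symbolic_power I n)))
                           (integral_closure (ideal_power I n)))"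

end

theory Submission
  imports Defs
begin

text \<open>
  All ideals in question are spanned by monomials, so that each of them is given by an up-closed
  set of exponent vectors. Let \<open>C n\<close> be the set of exponents of the saturation of the \<open>n\<close>-th power
  of \<open>I\<close>, which is the symbolic power by hypothesis, and let \<open>A n\<close> be the set of exponents of its
  integral closure. The defect is at most the number of minimal elements of \<open>A n\<close>
  (lemma \<open>num_gens_quot_le\<close>), and it suffices to bound this number by a multiple of \<open>n ^ (r - 2)\<close>.

  For \<open>C n\<close> in place of \<open>A n\<close> this is a short argument (lemma \<open>card_minimal_sat_exps\<close>). The set \<open>C n\<close>
  is the intersection of sets \<open>C\<^sub>j n\<close>, one for each variable, where \<open>C\<^sub>j n\<close> comes from the
  \<open>n\<close>-th power of the ideal obtained from \<open>I\<close> by setting the variable \<open>j\<close> to 1; it imposes no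
  condition on the coordinate \<open>j\<close>. If \<open>u\<close> is minimal in \<open>C n\<close> and \<open>u\<^sub>i > 0\<close>, then lowering \<open>u\<^sub>i\<close> by one
  leads out of some \<open>C\<^sub>j n\<close>, and \<open>j\<close> differs from \<open>i\<close>. Hence \<open>u\<^sub>i\<close> is the least value that \<open>C\<^sub>j n\<close> allows,
  given the coordinates other than \<open>i\<close> and \<open>j\<close>; after that, \<open>u\<^sub>j\<close> is determined by minimality. So \<open>u\<close>
  is determined by \<open>i\<close>, \<open>j\<close> and \<open>r - 2\<close> coordinates, each of which is at most a constant times \<open>n\<close>.

  The integral closure of a saturated ideal need not be saturated, so the argument cannot be
  repeated for \<open>A n\<close>. But the sets \<open>A n\<close> together form a finitely generated module over the monoid
  formed by the sets \<open>C n\<close>: there are finitely many pairs \<open>(h, m)\<close> with \<open>h \<in> A m\<close> such that every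
  \<open>A n\<close> is the union of the translates \<open>h + C (n - m)\<close>
  (lemma \<open>newton_closure_sat_exps_finitely_generated\<close>). For the proof, round down the rational
  coefficients that express an element of \<open>A n\<close> in terms of generators; the errors are bounded, and
  Dickson's lemma applies. A minimal element of \<open>A n\<close> is then a sum of some \<open>h\<close> and a
  minimal element of \<open>C (n - m)\<close>, which gives the bound.

  The computation of \<open>A n\<close> needs the description of the integral closure of a monomial ideal by
  exponents: \<open>u\<close> belongs to it if and only if some multiple \<open>m u\<close>, \<open>m \<ge> 1\<close>, is the exponent of an
  element of the \<open>m\<close>-th power (lemma \<open>integral_closure_mono_span\<close>). That the monomials with this
  property span an ideal of integral elements is shown by elimination in a system of linear
  equations; that there are no other integral elements follows by looking at leading monomials.

  The argument requires at least two variables. With one variable the bound is \<open>O(1/n)\<close>, so that the defect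
  has to vanish. If \<open>I\<close> is neither zero nor the unit ideal, then the maximal ideal is associated to
  \<open>R/I\<close>, so that 1 is not in the first symbolic power, while it is in the saturation. The hypothesis
  excludes this case, and in the other two cases both integral closures agree.
\<close>

section \<open>Dickson's lemma\<close>

lemma nat_seq_mono_subseq:
  fixes s :: "nat \<Rightarrow> nat"
  obtains \<phi> :: "nat \<Rightarrow> nat" where "strict_mono \<phi>" and "mono (\<lambda>t. s (\<phi> t))"
proof -
  obtain \<psi> :: "nat \<Rightarrow> nat" where \<psi>: "strict_mono \<psi>" and ms: "monoseq (\<lambda>t. s (\<psi> t))"
    using seq_monosub[of s] by blast
  show ?thesis
  proof (cases "incseq (\<lambda>t. s (\<psi> t))")
    case True
    then show ?thesis using \<psi> by (intro that[of \<psi>]) auto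
  next
    case False
    with ms have dec: "decseq (\<lambda>t. s (\<psi> t))"
      by (auto simp: monoseq_iff)
    define m where "m = (LEAST x. x \<in> range (\<lambda>t. s (\<psi> t)))"
    have "m \<in> range (\<lambda>t. s (\<psi> t))"
      unfolding m_def by (rule LeastI_ex) blast
    then obtain t0 where t0: "m = s (\<psi> t0)" by blast
    have "s (\<psi> (t + t0)) = m" for t
    proof (rule antisym)
      show "s (\<psi> (t + t0)) \<le> m"
        using decseqD[OF dec, of t0 "t + t0"] t0 by simp
      show "m \<le> s (\<psi> (t + t0))"
        unfolding m_def by (rule Least_le) blast
    qed
    then have "mono (\<lambda>t. s (\<psi> (t + t0)))" by (simp add: mono_def)
    moreover have "strict_mono (\<lambda>t. \<psi> (t + t0))"
      using \<psi> by (simp add: strict_mono_def)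
    ultimately show ?thesis by (rule that[rotated])
  qed
qed

lemma dickson_subseq:
  fixes z :: "nat \<Rightarrow> 'a" and Fs :: "('a \<Rightarrow> nat) set"
  assumes "finite Fs"
  shows "\<exists>\<phi> :: nat \<Rightarrow> nat. strict_mono \<phi> \<and> (\<forall>f\<in>Fs. mono (\<lambda>t. f (z (\<phi> t))))"
  using assms
proof (induction Fs)
  case empty
  show ?case by (rule exI[of _ id]) (simp add: strict_mono_def)
next
  case (insert f Fs)
  then obtain \<phi> :: "nat \<Rightarrow> nat" where \<phi>: "strict_mono \<phi>" "\<forall>f\<in>Fs. mono (\<lambda>t. f (z (\<phi> t)))"
    by blast
  obtain \<psi> :: "nat \<Rightarrow> nat" where \<psi>: "strict_mono \<psi>" "mono (\<lambda>t. f (z (\<phi> (\<psi> t))))"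
    using nat_seq_mono_subseq[of "\<lambda>t. f (z (\<phi> t))"] by blast
  have "mono \<psi>" using \<psi>(1) by (rule strict_mono_mono)
  have "mono (\<lambda>t. g (z (\<phi> (\<psi> t))))" if "g \<in> Fs" for g
  proof -
    have "mono (\<lambda>t. g (z (\<phi> t)))" using \<phi>(2) that by blast
    then show ?thesis using \<open>mono \<psi>\<close> by (auto simp: mono_def)
  qed
  with \<psi> have "\<forall>g\<in>insert f Fs. mono (\<lambda>t. g (z (\<phi> (\<psi> t))))" by blast
  moreover have "strict_mono (\<lambda>t. \<phi> (\<psi> t))"
    using \<phi>(1) \<psi>(1) by (simp add: strict_mono_def)
  ultimately show ?case by blast
qed

text \<open>
  Dickson's lemma, with a finite set of functions in the role of the coordinates. It will be applied
  to exponent vectors, and also to objects that carry coefficient vectors as additional data. A set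
  without such a finite subset would contain a sequence none of whose terms dominates an earlier
  one, against the existence of a subsequence on which all functions in \<open>Fs\<close> are monotone.
\<close>

lemma dickson_basis:
  fixes Z :: "'a set" and Fs :: "('a \<Rightarrow> nat) set"
  assumes "finite Fs"
  obtains H where "finite H" "H \<subseteq> Z" "\<And>z. z \<in> Z \<Longrightarrow> \<exists>h\<in>H. \<forall>f\<in>Fs. f h \<le> f z"
proof (rule ccontr)
  note obtained = that
  assume nt: "\<not> thesis"
  have no: "\<exists>z\<in>Z. \<forall>h\<in>H. \<exists>f\<in>Fs. f z < f h" if H: "finite H" "H \<subseteq> Z" for H
  proof (rule ccontr)
    assume *: "\<not> ?thesis"
    have "thesis"
    proof (rule obtained[OF H])
      fix z assume "z \<in> Z"
      with * have "\<not> (\<forall>h\<in>H. \<exists>f\<in>Fs. f z < f h)" by blast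
      then show "\<exists>h\<in>H. \<forall>f\<in>Fs. f h \<le> f z" by (simp add: not_less)
    qed
    with nt show False ..
  qed
  have "\<exists>z :: nat \<Rightarrow> 'a. \<forall>t. z t \<in> Z \<and> (\<forall>s<t. \<exists>f\<in>Fs. f (z t) < f (z s))"
  proof -
    define P where "P = (\<lambda>(xs :: 'a list) z. z \<in> Z \<and> (\<forall>h\<in>set xs. \<exists>f\<in>Fs. f z < f h))"
    define step where "step xs = xs @ [SOME z. P xs z]" for xs
    define L where "L t = (step ^^ t) []" for t
    have L_Suc: "L (Suc t) = L t @ [SOME z. P (L t) z]" for t
      by (simp add: L_def step_def)
    have P: "P (L t) (SOME z. P (L t) z)" if "set (L t) \<subseteq> Z" for t
    proof -
      have "\<exists>z. P (L t) z"
        unfolding P_def using no[OF finite_set that] by blast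
      then show ?thesis by (rule someI_ex)
    qed
    have sub: "set (L t) \<subseteq> Z" for t
    proof (induction t)
      case 0
      then show ?case by (simp add: L_def)
    next
      case (Suc t)
      then show ?case using P[OF Suc] unfolding L_Suc by (auto simp: P_def)
    qed
    define z where "z t = (SOME z. P (L t) z)" for t
    have zL: "z s \<in> set (L t)" if "s < t" for s t
      using that
    proof (induction t)
      case (Suc t)
      then show ?case by (cases "s = t") (auto simp: L_Suc z_def)
    qed simp
    have Pz: "P (L t) (z t)" for t using P[OF sub] by (simp add: z_def)
    have "z t \<in> Z \<and> (\<forall>s<t. \<exists>f\<in>Fs. f (z t) < f (z s))" for t
    proof (intro conjI allI impI)
      show "z t \<in> Z" using Pz[of t] by (simp add: P_def)
      fix s assume "s < t"
      then have "z s \<in> set (L t)" by (rule zL)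
      then show "\<exists>f\<in>Fs. f (z t) < f (z s)" using Pz[of t] by (simp add: P_def)
    qed
    then show ?thesis by blast
  qed
  then obtain z :: "nat \<Rightarrow> 'a" where z: "\<And>t. z t \<in> Z" "\<And>s t. s < t \<Longrightarrow> \<exists>f\<in>Fs. f (z t) < f (z s)"
    by blast
  obtain \<phi> :: "nat \<Rightarrow> nat" where \<phi>: "strict_mono \<phi>" "\<forall>f\<in>Fs. mono (\<lambda>t. f (z (\<phi> t)))"
    using dickson_subseq[OF assms, of z] by blast
  obtain f where f: "f \<in> Fs" "f (z (\<phi> 1)) < f (z (\<phi> 0))"
    using z(2)[of "\<phi> 0" "\<phi> 1"] \<phi>(1) by (auto simp: strict_mono_def)
  have "f (z (\<phi> 0)) \<le> f (z (\<phi> 1))"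
    using \<phi>(2) f(1) by (simp add: mono_def)
  with f(2) show False by simp
qed

section \<open>Sets of exponent vectors\<close>

definition up_closed :: "('n \<Rightarrow>\<^sub>0 nat) set \<Rightarrow> bool" where
  "up_closed U \<longleftrightarrow> (\<forall>u\<in>U. \<forall>w. u + w \<in> U)"

definition upset :: "('n \<Rightarrow>\<^sub>0 nat) set \<Rightarrow> ('n \<Rightarrow>\<^sub>0 nat) set" where
  "upset E = {g + w |g w. g \<in> E}"

definition sumset :: "('n \<Rightarrow>\<^sub>0 nat) set \<Rightarrow> ('n \<Rightarrow>\<^sub>0 nat) set \<Rightarrow> ('n \<Rightarrow>\<^sub>0 nat) set" where
  "sumset U Y = {u + v |u v. u \<in> U \<and> v \<in> Y}"

text \<open>
  The exponents of the powers of an ideal: for \<open>n = 0\<close> this is the unit ideal, hence \<open>UNIV\<close> and not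
  the neutral element \<open>{0}\<close> of the addition of sets.
\<close>

primrec npow :: "('n \<Rightarrow>\<^sub>0 nat) set \<Rightarrow> nat \<Rightarrow> ('n \<Rightarrow>\<^sub>0 nat) set" where
  "npow U 0 = UNIV"
| "npow U (Suc n) = sumset (npow U n) U"

definition nmul :: "nat \<Rightarrow> ('n \<Rightarrow>\<^sub>0 nat) \<Rightarrow> ('n \<Rightarrow>\<^sub>0 nat)" where
  "nmul m u = (\<Sum>i<m. u)"

abbreviation unit_exp :: "'n \<Rightarrow> ('n \<Rightarrow>\<^sub>0 nat)" where
  "unit_exp i \<equiv> Poly_Mapping.single i 1"

lemma lookup_nmul [simp]: "Poly_Mapping.lookup (nmul m u) k = m * Poly_Mapping.lookup u k"
  by (simp add: nmul_def lookup_sum)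

lemma exponent_neq_0_obtain:
  fixes u :: "'n \<Rightarrow>\<^sub>0 nat"
  assumes "u \<noteq> 0"
  obtains i where "Poly_Mapping.lookup u i > 0"
proof (rule ccontr)
  assume "\<not> thesis"
  with that have "Poly_Mapping.lookup u i = 0" for i by blast
  then have "u = 0" by (intro poly_mapping_eqI) simp
  with assms show False ..
qed

lemma nmul_add: "nmul (a + b) u = nmul a u + nmul b u"
  by (rule poly_mapping_eqI) (simp add: lookup_add algebra_simps)

lemma nmul_add_right: "nmul a (u + v) = nmul a u + nmul a v"
  by (rule poly_mapping_eqI) (simp add: lookup_add algebra_simps)

lemma nmul_mult: "nmul (a * b) u = nmul a (nmul b u)"
  by (rule poly_mapping_eqI) (simp add: algebra_simps)

lemma nmul_0 [simp]: "nmul 0 u = 0"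
  by (rule poly_mapping_eqI) simp

lemma nmul_Suc: "nmul (Suc m) u = nmul m u + u"
  by (rule poly_mapping_eqI) (simp add: lookup_add)

lemma pointwise_le_imp_add:
  fixes u v :: "'n \<Rightarrow>\<^sub>0 nat"
  assumes "\<And>k. Poly_Mapping.lookup u k \<le> Poly_Mapping.lookup v k"
  shows "u + (v - u) = v"
  by (rule poly_mapping_eqI) (simp add: lookup_add lookup_minus assms)

lemma up_closedD: "up_closed U \<Longrightarrow> u \<in> U \<Longrightarrow> u + w \<in> U"
  by (simp add: up_closed_def)

lemma up_closed_le:
  assumes "up_closed U" "u \<in> U" "\<And>k. Poly_Mapping.lookup u k \<le> Poly_Mapping.lookup v k"
  shows "v \<in> U"
  using up_closedD[OF assms(1,2), of "v - u"] pointwise_le_imp_add[OF assms(3)] by simp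

lemma up_closed_UNIV [simp]: "up_closed UNIV"
  by (simp add: up_closed_def)

lemma up_closed_upset [simp]: "up_closed (upset E)"
  by (fastforce simp: up_closed_def upset_def add.assoc)

lemma upset_superset: "E \<subseteq> upset E"
proof
  fix g assume "g \<in> E"
  then have "g + 0 \<in> upset E" unfolding upset_def by blast
  then show "g \<in> upset E" by simp
qed

lemma up_closed_sumset: "up_closed Y \<Longrightarrow> up_closed (sumset U Y)"
  unfolding up_closed_def sumset_def by (fastforce simp: add.assoc)

lemma up_closed_npow [simp]: "up_closed U \<Longrightarrow> up_closed (npow U n)"
  by (cases n) (auto intro: up_closed_sumset)

lemma npow_mono: "U \<subseteq> Y \<Longrightarrow> npow U n \<subseteq> npow Y n"
  by (induction n) (fastforce simp: sumset_def)+

lemma npow_add: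
  assumes "up_closed U" "u \<in> npow U a" "v \<in> npow U b"
  shows "u + v \<in> npow U (a + b)"
  using assms(3)
proof (induction b arbitrary: v)
  case 0
  then show ?case using up_closedD[OF up_closed_npow[OF assms(1)] assms(2)] by simp
next
  case (Suc b)
  then obtain v' x where "v = v' + x" "v' \<in> npow U b" "x \<in> U"
    by (auto simp: sumset_def)
  then show ?case using Suc.IH[of v'] by (auto simp: sumset_def add.assoc[symmetric])
qed

lemma npow_antimono:
  assumes "up_closed U" "a \<le> b"
  shows "npow U b \<subseteq> npow U a"
  using assms(2)
proof (induction b rule: dec_induct)
  case (step b)
  have "npow U (Suc b) \<subseteq> npow U b"
    using up_closedD[OF up_closed_npow[OF assms(1)]] by (auto simp: sumset_def)
  with step show ?case by blast
qed simp

lemma npow_nmul: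
  assumes "up_closed U" "u \<in> npow U a"
  shows "nmul k u \<in> npow U (k * a)"
proof (induction k)
  case (Suc k)
  show ?case using npow_add[OF assms(1) Suc assms(2)] by (simp add: nmul_Suc add.commute)
qed simp

lemma npow_nmul1: "up_closed U \<Longrightarrow> u \<in> U \<Longrightarrow> nmul k u \<in> npow U k"
proof (induction k)
  case (Suc k)
  then show ?case by (auto simp: nmul_Suc sumset_def)
qed simp

lemma npow_Suc_0 [simp]: "up_closed U \<Longrightarrow> npow U (Suc 0) = U"
  by (auto simp: sumset_def up_closed_def) (metis add.commute add_0)+

lemma upset_finite_basis:
  fixes U :: "('n::finite \<Rightarrow>\<^sub>0 nat) set"
  obtains E where "finite E" "E \<subseteq> U" "U \<subseteq> upset E"
proof -
  define Fs where "Fs = (\<lambda>k (u :: 'n \<Rightarrow>\<^sub>0 nat). Poly_Mapping.lookup u k) ` UNIV"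
  have "finite Fs" by (simp add: Fs_def)
  then obtain E where E: "finite E" "E \<subseteq> U" "\<And>z. z \<in> U \<Longrightarrow> \<exists>h\<in>E. \<forall>f\<in>Fs. f h \<le> f z"
    using dickson_basis[OF \<open>finite Fs\<close>, of U] by metis
  have "z \<in> upset E" if z: "z \<in> U" for z
  proof -
    obtain h where h: "h \<in> E" "\<forall>f\<in>Fs. f h \<le> f z" using E(3)[OF z] by blast
    then have "\<And>k. Poly_Mapping.lookup h k \<le> Poly_Mapping.lookup z k"
      by (auto simp: Fs_def)
    then have "h + (z - h) = z" by (rule pointwise_le_imp_add)
    then show ?thesis using h(1) unfolding upset_def by (metis (mono_tags, lifting) mem_Collect_eq)
  qed
  then show ?thesis using that E by blast
qed

lemma upset_subset: "up_closed U \<Longrightarrow> E \<subseteq> U \<Longrightarrow> upset E \<subseteq> U"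
  by (auto simp: upset_def up_closed_def)

lemma upset_finite_basis_eq:
  fixes U :: "('n::finite \<Rightarrow>\<^sub>0 nat) set"
  assumes "up_closed U"
  obtains E where "finite E" "U = upset E"
  using upset_finite_basis[of U] upset_subset[OF assms] by (metis subset_antisym)

text \<open>
  A monomial lies in the \<open>n\<close>-th power if and only if it is divisible by a product of \<open>n\<close> generators;
  \<open>x g\<close> is the multiplicity of the generator \<open>g\<close> in the product.
\<close>

lemma npow_upset_iff:
  fixes E :: "('n \<Rightarrow>\<^sub>0 nat) set"
  assumes "finite E"
  shows "u \<in> npow (upset E) n \<longleftrightarrow>
    (\<exists>x. (\<Sum>g\<in>E. x g) = n \<and>
       (\<forall>k. (\<Sum>g\<in>E. x g * Poly_Mapping.lookup g k) \<le> Poly_Mapping.lookup u k))"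
proof (induction n arbitrary: u)
  case 0
  then show ?case using assms by (auto intro: exI[of _ "\<lambda>_. 0"])
next
  case (Suc n)
  show ?case
  proof
    assume "u \<in> npow (upset E) (Suc n)"
    then obtain v g w where u: "u = v + (g + w)" "v \<in> npow (upset E) n" "g \<in> E"
      by (auto simp: sumset_def upset_def)
    obtain x where x: "sum x E = n"
      "\<And>k. (\<Sum>g\<in>E. x g * Poly_Mapping.lookup g k) \<le> Poly_Mapping.lookup v k"
      using u(2) Suc.IH by blast
    define x' where "x' = (\<lambda>h. x h + of_bool (h = g))"
    have e: "(\<Sum>h\<in>E. of_bool (h = g) * c h) = (c g :: nat)" for c
    proof -
      have "(\<Sum>h\<in>E. of_bool (h = g) * c h) = (\<Sum>h\<in>E. if h = g then c h else 0)"
        by (intro sum.cong) auto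
      then show ?thesis using u(3) assms by simp
    qed
    have "sum x' E = Suc n"
      using e[of "\<lambda>_. 1"] x(1) by (simp add: x'_def sum.distrib)
    moreover have "(\<Sum>h\<in>E. x' h * Poly_Mapping.lookup h k) \<le> Poly_Mapping.lookup u k" for k
      using e[of "\<lambda>h. Poly_Mapping.lookup h k"] x(2)[of k]
      by (simp add: x'_def sum.distrib add_mult_distrib u(1) lookup_add)
    ultimately show "\<exists>x. sum x E = Suc n \<and>
       (\<forall>k. (\<Sum>g\<in>E. x g * Poly_Mapping.lookup g k) \<le> Poly_Mapping.lookup u k)" by blast
  next
    assume "\<exists>x. sum x E = Suc n \<and>
       (\<forall>k. (\<Sum>g\<in>E. x g * Poly_Mapping.lookup g k) \<le> Poly_Mapping.lookup u k)"
    then obtain x where x: "sum x E = Suc n"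
      "\<And>k. (\<Sum>g\<in>E. x g * Poly_Mapping.lookup g k) \<le> Poly_Mapping.lookup u k" by blast
    obtain g where g: "g \<in> E" "x g > 0"
      using x(1) by (metis gr0I less_Suc_eq_0_disj not_gr0 sum.neutral zero_less_Suc)
    define x' where "x' = x(g := x g - 1)"
    have spl: "(\<Sum>h\<in>E. x h * c h) = c g + (\<Sum>h\<in>E. x' h * c h)" for c :: "_ \<Rightarrow> nat"
    proof -
      have "(\<Sum>h\<in>E. x h * c h) = x g * c g + (\<Sum>h\<in>E - {g}. x h * c h)"
        using assms g(1) by (simp add: sum.remove)
      moreover have "(\<Sum>h\<in>E. x' h * c h) = x' g * c g + (\<Sum>h\<in>E - {g}. x' h * c h)"
        using assms g(1) by (simp add: sum.remove)
      moreover have "(\<Sum>h\<in>E - {g}. x' h * c h) = (\<Sum>h\<in>E - {g}. x h * c h)"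
        by (intro sum.cong) (auto simp: x'_def)
      moreover have "x g * c g = c g + x' g * c g"
        using g(2) by (cases "x g") (auto simp: x'_def)
      ultimately show ?thesis by simp
    qed
    have "sum x' E = n" using spl[of "\<lambda>_. 1"] x(1) by simp
    moreover have le: "Poly_Mapping.lookup g k + (\<Sum>h\<in>E. x' h * Poly_Mapping.lookup h k) \<le> Poly_Mapping.lookup u k" for k
      using x(2)[of k] spl[of "\<lambda>h. Poly_Mapping.lookup h k"] by simp
    ultimately have "u - g \<in> npow (upset E) n"
      unfolding Suc.IH by (auto simp: lookup_minus le_diff_conv2 intro!: exI[of _ x'])
         (metis add.commute add_leD1 le_diff_conv2)
    moreover have "(u - g) + g = u"
    proof -
      have "g + (u - g) = u" using le by (intro pointwise_le_imp_add) (metis add_leD1)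
      then show ?thesis by (simp add: add.commute)
    qed
    moreover have "g \<in> upset E" using g(1) upset_superset by blast
    ultimately show "u \<in> npow (upset E) (Suc n)"
      by (simp add: sumset_def) metis
  qed
qed

section \<open>Ideals spanned by monomials\<close>

definition mono_span :: "('n \<Rightarrow>\<^sub>0 nat) set \<Rightarrow> ('n, 'k::field) mpoly set" where
  "mono_span U = {f. Poly_Mapping.keys f \<subseteq> U}"

lemma mono_span_0 [simp]: "0 \<in> mono_span U"
  by (simp add: mono_span_def)

lemma mono_span_add: "f \<in> mono_span U \<Longrightarrow> g \<in> mono_span U \<Longrightarrow> f + g \<in> mono_span U"
  using keys_add[of f g] by (auto simp: mono_span_def)

lemma mono_span_uminus: "f \<in> mono_span U \<Longrightarrow> - f \<in> mono_span U"
  by (auto simp: mono_span_def in_keys_iff)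

lemma mono_span_diff: "f \<in> mono_span U \<Longrightarrow> g \<in> mono_span U \<Longrightarrow> f - g \<in> mono_span U"
  using mono_span_add[of f U "- g"] mono_span_uminus[of g U] by simp

lemma mono_span_sum: "(\<And>i. i \<in> A \<Longrightarrow> f i \<in> mono_span U) \<Longrightarrow> (\<Sum>i\<in>A. f i) \<in> mono_span U"
  by (induction A rule: infinite_finite_induct) (auto intro: mono_span_add)

lemma mono_span_mult:
  "f \<in> mono_span U \<Longrightarrow> g \<in> mono_span V \<Longrightarrow> f * g \<in> mono_span (sumset U V)"
  using keys_mult[of f g] by (fastforce simp: mono_span_def sumset_def)

lemma mono_span_mult_left:
  assumes "up_closed U" "g \<in> mono_span U"
  shows "f * g \<in> mono_span U"
proof -
  have "f * g \<in> mono_span (sumset UNIV U)"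
    by (rule mono_span_mult) (auto simp: mono_span_def assms(2)[unfolded mono_span_def, simplified])
  moreover have "sumset UNIV U \<subseteq> U"
    using assms(1) by (auto simp: sumset_def up_closed_def) (metis add.commute)
  ultimately show ?thesis by (auto simp: mono_span_def)
qed

lemma mono_span_mono: "U \<subseteq> V \<Longrightarrow> mono_span U \<subseteq> mono_span V"
  by (auto simp: mono_span_def)

lemma mono_span_UNIV [simp]: "mono_span UNIV = UNIV"
  by (simp add: mono_span_def)

lemma single_in_mono_span: "u \<in> U \<Longrightarrow> Poly_Mapping.single u c \<in> mono_span U"
  by (auto simp: mono_span_def)

lemma monomial_in_mono_span_iff [simp]: "monomial u \<in> mono_span U \<longleftrightarrow> u \<in> U"
  by (auto simp: mono_span_def monomial_def)

lemma mpoly_eq_sum_single: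
  "f = (\<Sum>u\<in>Poly_Mapping.keys f. Poly_Mapping.single u (Poly_Mapping.lookup f u))"
proof (rule poly_mapping_eqI)
  fix v
  have "(\<Sum>u\<in>Poly_Mapping.keys f. Poly_Mapping.lookup (Poly_Mapping.single u (Poly_Mapping.lookup f u)) v)
      = (\<Sum>u\<in>Poly_Mapping.keys f. if u = v then Poly_Mapping.lookup f v else 0)"
    by (intro sum.cong) (auto simp: lookup_single when_def)
  then show "Poly_Mapping.lookup f v = Poly_Mapping.lookup
      (\<Sum>u\<in>Poly_Mapping.keys f. Poly_Mapping.single u (Poly_Mapping.lookup f u)) v"
    by (simp add: lookup_sum in_keys_iff)
qed

lemma single_eq_mconst_monomial: "Poly_Mapping.single u c = mconst c * monomial u"
  by (simp add: mconst_def monomial_def mult_single)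

lemma lookup_mconst_mult [simp]: "Poly_Mapping.lookup (mconst c * f) u = c * Poly_Mapping.lookup f u"
  unfolding mconst_def mult_map_scale_conv_mult[symmetric]
  by (simp add: map.rep_eq when_def)

lemma mono_span_induct [consumes 1, case_names zero add single]:
  assumes "f \<in> mono_span U" "P 0" "\<And>f g. P f \<Longrightarrow> P g \<Longrightarrow> P (f + g)"
    "\<And>u c. u \<in> U \<Longrightarrow> P (Poly_Mapping.single u c)"
  shows "P f"
proof -
  have "P (\<Sum>u\<in>A. Poly_Mapping.single u (Poly_Mapping.lookup f u))" if "A \<subseteq> U" "finite A" for A
    using that(2,1) by (induction A) (auto intro: assms)
  from this[of "Poly_Mapping.keys f"] show ?thesis
    using assms(1) mpoly_eq_sum_single[of f] by (simp add: mono_span_def)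
qed

lemma ring_of_type_algebra_sel [simp]:
  "carrier (ring_of_type_algebra :: 'a::ring_1 ring) = UNIV"
  "monoid.mult (ring_of_type_algebra :: 'a ring) = (*)"
  "ring.add (ring_of_type_algebra :: 'a ring) = (+)"
  "ring.zero (ring_of_type_algebra :: 'a ring) = 0"
  "monoid.one (ring_of_type_algebra :: 'a ring) = 1"
  by (simp_all add: ring_of_type_algebra_def fun_eq_iff)

lemma cring_mpoly_ring: "cring (mpoly_ring :: ('n, 'k::field) mpoly ring)"
  by (rule cring_from_type_algebra)

lemma ring_mpoly_ring: "ring (mpoly_ring :: ('n, 'k::field) mpoly ring)"
  by (rule ring_from_type_algebra)

lemma a_inv_mpoly_ring [simp]: "a_inv (mpoly_ring :: ('n, 'k::field) mpoly ring) f = - f"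
proof -
  interpret cring "mpoly_ring :: ('n, 'k) mpoly ring" by (rule cring_mpoly_ring)
  show ?thesis using minus_equality[of "- f" f] by simp
qed

lemma ideal_mpoly_ringI:
  fixes J :: "('n, 'k::field) mpoly set"
  assumes "0 \<in> J" "\<And>f g. f \<in> J \<Longrightarrow> g \<in> J \<Longrightarrow> f + g \<in> J" "\<And>f g. g \<in> J \<Longrightarrow> f * g \<in> J"
  shows "ideal J mpoly_ring"
proof (rule idealI[OF ring_mpoly_ring])
  interpret cring "mpoly_ring :: ('n, 'k) mpoly ring" by (rule cring_mpoly_ring)
  show "subgroup J (add_monoid mpoly_ring)"
  proof (rule add.subgroupI)
    fix a assume "a \<in> J"
    then show "\<ominus>\<^bsub>mpoly_ring\<^esub> a \<in> J" using assms(3)[of a "- 1"] by simp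
  qed (use assms in auto)
qed (use assms(3) in \<open>auto simp: mult.commute\<close>)

lemma ideal_mpoly_ringD:
  fixes J :: "('n, 'k::field) mpoly set"
  assumes "ideal J mpoly_ring"
  shows "0 \<in> J" "\<And>f g. f \<in> J \<Longrightarrow> g \<in> J \<Longrightarrow> f + g \<in> J" "\<And>f g. g \<in> J \<Longrightarrow> f * g \<in> J"
proof -
  interpret ideal J mpoly_ring by fact
  show "0 \<in> J" using additive_subgroup.zero_closed[OF ideal.axioms(1)[OF assms]] by simp
  show "f + g \<in> J" if "f \<in> J" "g \<in> J" for f g using additive_subgroup.a_closed[OF ideal.axioms(1)[OF assms] that] by simp
  show "f * g \<in> J" if "g \<in> J" for f g using I_l_closed[OF that, of f] by simp
qed

lemma ideal_mono_span: "up_closed U \<Longrightarrow> ideal (mono_span U) mpoly_ring"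
  by (intro ideal_mpoly_ringI mono_span_0 mono_span_add mono_span_mult_left)

lemma genideal_monomials:
  "Idl\<^bsub>mpoly_ring\<^esub> (monomial ` E) = (mono_span (upset E) :: ('n, 'k::field) mpoly set)"
proof
  have sub: "monomial ` E \<subseteq> (mono_span (upset E) :: ('n, 'k::field) mpoly set)"
    by (auto intro: subsetD[OF upset_superset])
  show "Idl\<^bsub>mpoly_ring\<^esub> (monomial ` E) \<subseteq> (mono_span (upset E) :: ('n, 'k::field) mpoly set)"
    by (rule ring.genideal_minimal[OF ring_mpoly_ring ideal_mono_span sub]) simp
  show "mono_span (upset E) \<subseteq> Idl\<^bsub>mpoly_ring\<^esub> (monomial ` E :: ('n, 'k::field) mpoly set)"
  proof
    have id: "ideal (Idl\<^bsub>mpoly_ring\<^esub> (monomial ` E :: ('n, 'k::field) mpoly set)) mpoly_ring"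
      by (rule ring.genideal_ideal[OF ring_mpoly_ring]) simp
    have self: "monomial ` E \<subseteq> Idl\<^bsub>mpoly_ring\<^esub> (monomial ` E :: ('n, 'k::field) mpoly set)"
      by (rule ring.genideal_self[OF ring_mpoly_ring]) simp
    fix f :: "('n, 'k::field) mpoly"
    assume "f \<in> mono_span (upset E)"
    then show "f \<in> Idl\<^bsub>mpoly_ring\<^esub> (monomial ` E)"
    proof (induction rule: mono_span_induct)
      case (single u c)
      then obtain g w where u: "u = g + w" "g \<in> E" by (auto simp: upset_def)
      have "Poly_Mapping.single u c = Poly_Mapping.single w c * monomial g"
        by (simp add: u(1) monomial_def mult_single add.commute)
      then show ?case using ideal_mpoly_ringD(3)[OF id] self u(2) by auto
    qed (use ideal_mpoly_ringD[OF id] in auto)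
  qed
qed

lemma ideal_prod_mono_span:
  "ideal_prod mpoly_ring (mono_span U) (mono_span V) =
     (mono_span (sumset U V) :: ('n, 'k::field) mpoly set)"
proof
  show "ideal_prod mpoly_ring (mono_span U) (mono_span V) \<subseteq>
      (mono_span (sumset U V) :: ('n, 'k::field) mpoly set)"
  proof
    fix f :: "('n, 'k) mpoly"
    assume "f \<in> ideal_prod mpoly_ring (mono_span U) (mono_span V)"
    then show "f \<in> mono_span (sumset U V)"
      by induction (auto intro: mono_span_add mono_span_mult)
  qed
  show "(mono_span (sumset U V) :: ('n, 'k::field) mpoly set) \<subseteq>
      ideal_prod mpoly_ring (mono_span U) (mono_span V)"
  proof
    fix f :: "('n, 'k) mpoly"
    assume "f \<in> mono_span (sumset U V)"
    then show "f \<in> ideal_prod mpoly_ring (mono_span U) (mono_span V)"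
    proof (induction rule: mono_span_induct)
      case zero
      show ?case
        using ideal_prod.prod[of 0 "mono_span U :: ('n, 'k) mpoly set" 0 "mono_span V" mpoly_ring]
        by simp
    next
      case (add f g)
      then show ?case
        using ideal_prod.sum[of f mpoly_ring "mono_span U" "mono_span V" g] by simp
    next
      case (single w c)
      then obtain u v where w: "w = u + v" "u \<in> U" "v \<in> V" by (auto simp: sumset_def)
      have "Poly_Mapping.single w c = Poly_Mapping.single u c * (monomial v :: ('n, 'k) mpoly)"
        by (simp add: w(1) monomial_def mult_single)
      then show ?case
        using ideal_prod.prod[of "Poly_Mapping.single u c" "mono_span U :: ('n, 'k) mpoly set"
            "monomial v" "mono_span V" mpoly_ring] w(2,3)
        by (simp add: single_in_mono_span)
    qed
  qed
qed

lemma ideal_power_mono_span: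
  "ideal_power (mono_span U) n = (mono_span (npow U n) :: ('n, 'k::field) mpoly set)"
proof (induction n)
  case 0
  show ?case by (simp add: nat_pow_def ideals_set_def)
next
  case (Suc n)
  then show ?case by (simp add: nat_pow_def ideals_set_def ideal_prod_mono_span)
qed

lemma max_ideal_eq:
  "max_ideal = (mono_span (upset (range unit_exp)) :: ('n, 'k::field) mpoly set)"
proof -
  have "range mvar = (monomial ` range unit_exp :: ('n, 'k) mpoly set)"
    by (auto simp: mvar_def)
  then show ?thesis unfolding max_ideal_def by (simp only: genideal_monomials)
qed

section \<open>Exponents of integral elements\<close>

text \<open>
  For an up-closed set \<open>U\<close> these are the lattice points in the Newton polyhedron of \<open>U\<close>.
\<close>

definition newton_closure :: "('n \<Rightarrow>\<^sub>0 nat) set \<Rightarrow> ('n \<Rightarrow>\<^sub>0 nat) set" where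
  "newton_closure U = {u. \<exists>m\<ge>1. nmul m u \<in> npow U m}"

lemma up_closed_newton_closure: "up_closed U \<Longrightarrow> up_closed (newton_closure U)"
  unfolding up_closed_def[of "newton_closure U"]
  by (auto simp: newton_closure_def nmul_add_right intro: up_closedD[OF up_closed_npow])

lemma newton_closure_nmul:
  assumes "up_closed U" "u \<in> newton_closure U"
  obtains m where "m \<ge> 1" "\<And>t. nmul (t * m) u \<in> npow U (t * m)"
proof -
  obtain m where m: "m \<ge> 1" "nmul m u \<in> npow U m" using assms(2) by (auto simp: newton_closure_def)
  have "nmul (t * m) u \<in> npow U (t * m)" for t
    using npow_nmul[OF assms(1) m(2), of t] by (simp add: nmul_mult)
  with m(1) show ?thesis using that by blast
qed

text \<open>
  A bounded number \<open>c\<close> of missing factors does no harm. Choose for every \<open>m\<close> a product of \<open>m - c\<close>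
  generators that divides the monomial with exponent \<open>m v\<close>. By Dickson's lemma there are \<open>h < m\<close> such
  that the multiplicities and the cofactors for \<open>m\<close> dominate those for \<open>h\<close>. In the difference the
  missing factors cancel, and exactly \<open>m - h\<close> generators remain for the exponent \<open>(m - h) v\<close>.
\<close>

lemma in_newton_closure_if_multiples_almost_in_npow:
  fixes U :: "('n::finite \<Rightarrow>\<^sub>0 nat) set"
  assumes up: "up_closed U" and v: "\<And>m. nmul m v \<in> npow U (m - c)"
  shows "v \<in> newton_closure U"
proof -
  obtain E where E: "finite E" "U = upset E" by (rule upset_finite_basis_eq[OF up])
  have "\<forall>m. \<exists>x. (\<Sum>g\<in>E. x g) = m - c \<and>
      (\<forall>k. (\<Sum>g\<in>E. x g * Poly_Mapping.lookup g k) \<le> m * Poly_Mapping.lookup v k)"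
    using v unfolding E(2) npow_upset_iff[OF E(1)] by simp
  then obtain x where x: "\<And>m. (\<Sum>g\<in>E. x m g) = m - c"
      "\<And>m k. (\<Sum>g\<in>E. x m g * Poly_Mapping.lookup g k) \<le> m * Poly_Mapping.lookup v k"
    by metis
  \<comment> \<open>the exponent of the cofactor\<close>
  define s where "s m k = m * Poly_Mapping.lookup v k - (\<Sum>g\<in>E. x m g * Poly_Mapping.lookup g k)" for m k
  define Fs where "Fs = (\<lambda>g m. x m g) ` E \<union> range (\<lambda>k m. s m k)"
  have "finite Fs" using E(1) by (simp add: Fs_def)
  then obtain H where H: "finite H" "H \<subseteq> {c..}" "\<And>m. m \<in> {c..} \<Longrightarrow> \<exists>h\<in>H. \<forall>f\<in>Fs. f h \<le> f m"
    using dickson_basis[OF \<open>finite Fs\<close>, of "{c..}"] by metis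
  \<comment> \<open>larger than all indices in the finite set, so that the index below \<open>m\<close> found there is strictly smaller\<close>
  define m where "m = Suc (Max (insert c H))"
  have gt: "h < m" if "h \<in> insert c H" for h
    using that H(1) by (auto simp: m_def le_imp_less_Suc)
  then have "c \<le> m" by (simp add: less_imp_le)
  then obtain h where h: "h \<in> H" "\<forall>f\<in>Fs. f h \<le> f m" using H(3)[of m] by auto
  have hx: "x h g \<le> x m g" if "g \<in> E" for g using h(2) that by (auto simp: Fs_def)
  have hs: "s h k \<le> s m k" for k using h(2) by (auto simp: Fs_def)
  have hm: "h < m" "c \<le> h" using gt h(1) H(2) by auto
  define d where "d g = x m g - x h g" for g
  have spl: "(\<Sum>g\<in>E. x m g * w g) = (\<Sum>g\<in>E. x h g * w g) + (\<Sum>g\<in>E. d g * w g)" for w :: "_ \<Rightarrow> nat"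
    unfolding sum.distrib[symmetric] by (intro sum.cong) (auto simp: d_def hx add_mult_distrib[symmetric])
  have "(\<Sum>g\<in>E. d g) = m - h"
    using spl[of "\<lambda>_. 1"] x(1)[of m] x(1)[of h] hm \<open>c \<le> m\<close> by simp
  moreover have "(\<Sum>g\<in>E. d g * Poly_Mapping.lookup g k) \<le> (m - h) * Poly_Mapping.lookup v k" for k
  proof -
    have "m * Poly_Mapping.lookup v k = h * Poly_Mapping.lookup v k + (m - h) * Poly_Mapping.lookup v k"
      using hm by (simp add: add_mult_distrib[symmetric])
    then show ?thesis
      using spl[of "\<lambda>g. Poly_Mapping.lookup g k"] x(2)[of m k] x(2)[of h k] hs[of k]
      unfolding s_def by linarith
  qed
  ultimately have "nmul (m - h) v \<in> npow U (m - h)"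
    unfolding E(2) npow_upset_iff[OF E(1)] by (auto intro!: exI[of _ d])
  then show ?thesis using hm by (auto simp: newton_closure_def intro!: exI[of _ "m - h"])
qed

section \<open>Leading monomials\<close>

text \<open>
  The order on exponents is the lexicographic one, for which addition is strictly monotone, so that
  only one pair of terms contributes to the coefficient at \<open>a + b\<close>.
\<close>

lemma lookup_mult_leading:
  fixes f g :: "('n::linorder \<Rightarrow>\<^sub>0 nat) \<Rightarrow>\<^sub>0 'k::field"
  assumes f: "\<And>u. u \<in> Poly_Mapping.keys f \<Longrightarrow> u \<le> a" and g: "\<And>u. u \<in> Poly_Mapping.keys g \<Longrightarrow> u \<le> b"
  shows "Poly_Mapping.lookup (f * g) (a + b) = Poly_Mapping.lookup f a * Poly_Mapping.lookup g b"
proof -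
  have *: "Poly_Mapping.lookup f l * (\<Sum>q. Poly_Mapping.lookup g q when a + b = l + q)
      = (Poly_Mapping.lookup f a * Poly_Mapping.lookup g b when l = a)" for l
  proof (cases "l = a")
    case True
    then show ?thesis by (simp add: Sum_any_when_equal')
  next
    case False
    have "Poly_Mapping.lookup f l * (\<Sum>q. Poly_Mapping.lookup g q when a + b = l + q) = 0"
    proof (cases "l \<in> Poly_Mapping.keys f")
      case True
      with False f have "l < a" by (simp add: order_le_neq_trans)
      have "(Poly_Mapping.lookup g q when a + b = l + q) = 0" for q
      proof (rule ccontr)
        assume "\<not> ?thesis"
        then have "a + b = l + q" "q \<in> Poly_Mapping.keys g" by (auto simp: when_def in_keys_iff split: if_splits)
        moreover have "l + q < a + b" using \<open>l < a\<close> g[OF \<open>q \<in> _\<close>] by (rule add_less_le_mono)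
        ultimately show False by simp
      qed
      then show ?thesis by simp
    qed (simp add: in_keys_iff)
    with False show ?thesis by simp
  qed
  show ?thesis unfolding lookup_mult * by simp
qed

lemma lookup_power_leading:
  fixes f :: "('n::linorder \<Rightarrow>\<^sub>0 nat) \<Rightarrow>\<^sub>0 'k::field"
  assumes f: "\<And>u. u \<in> Poly_Mapping.keys f \<Longrightarrow> u \<le> a"
  shows "Poly_Mapping.lookup (f ^ m) (nmul m a) = Poly_Mapping.lookup f a ^ m"
    and "u \<in> Poly_Mapping.keys (f ^ m) \<Longrightarrow> u \<le> nmul m a"
proof (induction m arbitrary: u)
  case 0
  { case 1 show ?case by simp }
  { case 2 then show ?case by simp }
next
  case (Suc m)
  { case 1
    have "Poly_Mapping.lookup (f ^ m * f) (nmul m a + a) =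
        Poly_Mapping.lookup (f ^ m) (nmul m a) * Poly_Mapping.lookup f a"
      by (rule lookup_mult_leading[OF Suc(2) f])
    then show ?case using Suc(1) by (simp add: nmul_Suc mult.commute) }
  { case 2
    then obtain p q where "u = p + q" "p \<in> Poly_Mapping.keys (f ^ m)" "q \<in> Poly_Mapping.keys f"
      using keys_mult[of "f ^ m" f] by (auto simp: mult.commute)
    then show ?case using Suc(2)[of p] f[of q] by (simp add: nmul_Suc add_mono) }
qed

section \<open>Integral elements are spanned by monomials\<close>

text \<open>
  A consequence of integrality that is stable under sums for a simple reason, the binomial theorem.
  This makes it possible to remove the leading term of an integral element before it is known that
  the integral closure is closed under addition.
\<close>

definition almost_integral :: "('n \<Rightarrow>\<^sub>0 nat) set \<Rightarrow> ('n, 'k::field) mpoly \<Rightarrow> bool" where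
  "almost_integral U f \<longleftrightarrow> (\<exists>c. \<forall>m. f ^ m \<in> mono_span (npow U (m - c)))"

lemma mono_span_npow_mult:
  assumes "up_closed U" "f \<in> mono_span (npow U a)" "g \<in> mono_span (npow U b)" "c \<le> a + b"
  shows "f * g \<in> mono_span (npow U c)"
proof -
  have "sumset (npow U a) (npow U b) \<subseteq> npow U c"
    using npow_add[OF assms(1)] npow_antimono[OF assms(1,4)] by (auto simp: sumset_def)
  then show ?thesis using mono_span_mult[OF assms(2,3)] mono_span_mono by blast
qed

lemma integral_imp_almost_integral:
  fixes f :: "('n, 'k::field) mpoly"
  assumes up: "up_closed U" and f: "f \<in> integral_closure (mono_span U)"
  shows "almost_integral U f"
proof -
  obtain n a where n: "n \<ge> 1" and a: "\<And>i. i \<in> {1..n} \<Longrightarrow> a i \<in> mono_span (npow U i)"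
    and eq: "f ^ n + (\<Sum>i = 1..n. a i * f ^ (n - i)) = 0"
    using f unfolding integral_closure_def ideal_power_mono_span by blast
  have "f ^ m \<in> mono_span (npow U (m - n))" for m
  proof (induction m rule: less_induct)
    case (less m)
    show ?case
    proof (cases "m < n")
      case True
      then show ?thesis by simp
    next
      case False
      have "f ^ m = f ^ (m - n) * f ^ n" using False by (simp flip: power_add)
      also have "f ^ n = - (\<Sum>i = 1..n. a i * f ^ (n - i))" using eq by (simp add: eq_neg_iff_add_eq_0)
      finally have "f ^ m = - (\<Sum>i = 1..n. a i * (f ^ (m - n) * f ^ (n - i)))"
        by (simp add: sum_distrib_left mult.left_commute)
      also have "\<dots> = - (\<Sum>i = 1..n. a i * f ^ (m - i))"
        using False by (simp flip: power_add)
      also have "\<dots> \<in> mono_span (npow U (m - n))"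
      proof (intro mono_span_uminus mono_span_sum)
        fix i assume i: "i \<in> {1..n}"
        with False have "m - i < m" by auto
        show "a i * f ^ (m - i) \<in> mono_span (npow U (m - n))"
          by (rule mono_span_npow_mult[OF up a[OF i] less.IH[OF \<open>m - i < m\<close>]]) (use i False in auto)
      qed
      finally show ?thesis .
    qed
  qed
  then show ?thesis by (auto simp: almost_integral_def)
qed

lemma almost_integral_add:
  fixes f g :: "('n, 'k::field) mpoly"
  assumes up: "up_closed U" and f: "almost_integral U f" and g: "almost_integral U g"
  shows "almost_integral U (f + g)"
proof -
  obtain c d where c: "\<And>m. f ^ m \<in> mono_span (npow U (m - c))"
    and d: "\<And>m. g ^ m \<in> mono_span (npow U (m - d))"
    using f g unfolding almost_integral_def by blast
  have "(f + g) ^ m \<in> mono_span (npow U (m - (c + d)))" for m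
    unfolding binomial_ring
  proof (rule mono_span_sum)
    fix k assume k: "k \<in> {..m}"
    have "f ^ k * g ^ (m - k) \<in> mono_span (npow U (m - (c + d)))"
      by (rule mono_span_npow_mult[OF up c d]) (use k in auto)
    then show "of_nat (m choose k) * f ^ k * g ^ (m - k) \<in> mono_span (npow U (m - (c + d)))"
      unfolding mult.assoc by (rule mono_span_mult_left[OF up_closed_npow[OF up]])
  qed
  then show ?thesis by (auto simp: almost_integral_def)
qed

lemma almost_integral_single:
  assumes up: "up_closed U" and u: "u \<in> newton_closure U"
  shows "almost_integral U (Poly_Mapping.single u (c :: 'k::field))"
proof -
  obtain n where n: "n \<ge> 1" "\<And>t. nmul (t * n) u \<in> npow U (t * n)" using newton_closure_nmul[OF up u] by blast
  have "Poly_Mapping.single u c ^ m \<in> mono_span (npow U (m - n))" for m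
  proof -
    have "Poly_Mapping.single u c ^ m = Poly_Mapping.single (nmul m u) (c ^ m)"
      by (induction m) (simp_all add: nmul_Suc mult_single add.commute)
    moreover have "nmul m u \<in> npow U (m - n)"
    proof -
      have "nmul m u = nmul (m div n * n) u + nmul (m mod n) u"
        by (simp flip: nmul_add)
      then have "nmul m u \<in> npow U (m div n * n)"
        using up_closedD[OF up_closed_npow[OF up] n(2)] by simp
      moreover have "m - n \<le> m div n * n"
        using n(1) by (simp add: minus_mod_eq_div_mult[symmetric] diff_le_mono2 less_imp_le)
      ultimately show ?thesis using npow_antimono[OF up] by blast
    qed
    ultimately show ?thesis by (simp add: single_in_mono_span)
  qed
  then show ?thesis by (auto simp: almost_integral_def)
qed

text \<open>
  The power \<open>f ^ m\<close> contains the monomial with exponent \<open>m v\<close>, where \<open>v\<close> is the leading exponent of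
  \<open>f\<close>. Hence \<open>v\<close> is in the closure, the leading term is almost integral itself, and the difference has
  fewer terms.
\<close>

lemma keys_almost_integral:
  fixes f :: "('n::{finite,linorder}, 'k::field) mpoly"
  assumes up: "up_closed U"
  shows "almost_integral U f \<Longrightarrow> Poly_Mapping.keys f \<subseteq> newton_closure U"
proof (induction "card (Poly_Mapping.keys f)" arbitrary: f rule: less_induct)
  case less
  show ?case
  proof (cases "f = 0")
    case False
    then have ne: "Poly_Mapping.keys f \<noteq> {}" by simp
    define v where "v = Max (Poly_Mapping.keys f)"
    have v: "v \<in> Poly_Mapping.keys f" "\<And>u. u \<in> Poly_Mapping.keys f \<Longrightarrow> u \<le> v"
      using ne by (simp_all add: v_def)
    obtain c where c: "\<And>m. f ^ m \<in> mono_span (npow U (m - c))"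
      using less.prems unfolding almost_integral_def by blast
    have "nmul m v \<in> npow U (m - c)" for m
    proof -
      have "nmul m v \<in> Poly_Mapping.keys (f ^ m)"
        using v(1) lookup_power_leading(1)[of f v m, OF v(2)] by (simp add: in_keys_iff)
      then show ?thesis using c[of m] by (auto simp: mono_span_def)
    qed
    then have vcl: "v \<in> newton_closure U" by (rule in_newton_closure_if_multiples_almost_in_npow[OF up])
    define g where "g = f + Poly_Mapping.single v (- Poly_Mapping.lookup f v)"
    have keys: "Poly_Mapping.keys g = Poly_Mapping.keys f - {v}"
      by (auto simp: g_def in_keys_iff lookup_add lookup_single when_def split: if_splits)
    have "almost_integral U g"
      unfolding g_def by (intro almost_integral_add almost_integral_single up less.prems vcl)
    moreover have "card (Poly_Mapping.keys g) < card (Poly_Mapping.keys f)"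
      unfolding keys by (rule card_Diff1_less) (use v(1) in auto)
    ultimately have "Poly_Mapping.keys g \<subseteq> newton_closure U" by (intro less.hyps)
    then show ?thesis using keys vcl by auto
  qed simp
qed

section \<open>Spans of integral monomials consist of integral elements\<close>

text \<open>
  Thus \<open>f\<close> is integral over the ideal if and only if \<open>f ^ d + y = 0\<close> for some \<open>d \<ge> 1\<close> and some \<open>y\<close> in
  \<open>lower_terms U f d\<close>. The family is graded: these sets multiply like homogeneous components.
\<close>

definition lower_terms :: "('n \<Rightarrow>\<^sub>0 nat) set \<Rightarrow> ('n, 'k::field) mpoly \<Rightarrow> nat \<Rightarrow> ('n, 'k) mpoly set" where
  "lower_terms U f d = {(\<Sum>i=1..d. a i * f ^ (d - i)) |a. \<forall>i\<in>{1..d}. a i \<in> mono_span (npow U i)}"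

lemma lower_terms_add:
  "x \<in> lower_terms U f d \<Longrightarrow> y \<in> lower_terms U f d \<Longrightarrow> x + y \<in> lower_terms U f d"
proof -
  assume "x \<in> lower_terms U f d" "y \<in> lower_terms U f d"
  then obtain a b where "x = (\<Sum>i=1..d. a i * f ^ (d - i))" "\<forall>i\<in>{1..d}. a i \<in> mono_span (npow U i)"
    "y = (\<Sum>i=1..d. b i * f ^ (d - i))" "\<forall>i\<in>{1..d}. b i \<in> mono_span (npow U i)"
    by (auto simp: lower_terms_def)
  then show ?thesis
    unfolding lower_terms_def
    by (auto intro!: exI[of _ "\<lambda>i. a i + b i"] mono_span_add simp: sum.distrib distrib_right)
qed

lemma lower_terms_uminus:
  "x \<in> lower_terms U f d \<Longrightarrow> - x \<in> lower_terms U f d"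
proof -
  assume "x \<in> lower_terms U f d"
  then obtain a where "x = (\<Sum>i=1..d. a i * f ^ (d - i))" "\<forall>i\<in>{1..d}. a i \<in> mono_span (npow U i)"
    by (auto simp: lower_terms_def)
  then show ?thesis
    unfolding lower_terms_def
    by (auto intro!: exI[of _ "\<lambda>i. - a i"] mono_span_uminus simp: sum_negf)
qed

lemma lower_terms_0: "0 \<in> lower_terms U f d"
  unfolding lower_terms_def by (auto intro!: exI[of _ "\<lambda>i. 0"])

lemma lower_terms_sum:
  "(\<And>i. i \<in> A \<Longrightarrow> x i \<in> lower_terms U f d) \<Longrightarrow> (\<Sum>i\<in>A. x i) \<in> lower_terms U f d"
  by (induction A rule: infinite_finite_induct) (auto intro: lower_terms_add lower_terms_0)

lemma lower_terms_gen:
  assumes "i \<in> {1..d}" "a \<in> mono_span (npow U i)"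
  shows "a * f ^ (d - i) \<in> lower_terms U f d"
proof -
  have "(\<Sum>j=1..d. (if j = i then a else 0) * f ^ (d - j)) = (\<Sum>j=1..d. if j = i then a * f ^ (d - i) else 0)"
    by (intro sum.cong) auto
  also have "\<dots> = a * f ^ (d - i)" using assms(1) by simp
  finally show ?thesis
    using assms(2) unfolding lower_terms_def
    by (auto intro!: exI[of _ "\<lambda>j. if j = i then a else 0"])
qed

lemma lower_terms_power_mult:
  assumes "x \<in> lower_terms U f d"
  shows "f ^ e * x \<in> lower_terms U f (e + d)"
proof -
  obtain a where a: "x = (\<Sum>i=1..d. a i * f ^ (d - i))" "\<forall>i\<in>{1..d}. a i \<in> mono_span (npow U i)"
    using assms by (auto simp: lower_terms_def)
  have "f ^ e * x = (\<Sum>i=1..d. a i * f ^ (e + d - i))"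
    unfolding a(1) sum_distrib_left
    by (intro sum.cong) (auto simp: power_add[symmetric] mult.left_commute)
  also have "\<dots> \<in> lower_terms U f (e + d)"
    by (intro lower_terms_sum lower_terms_gen) (use a(2) in auto)
  finally show ?thesis .
qed

lemma lower_terms_mult:
  assumes up: "up_closed U" and "x \<in> lower_terms U f d" "y \<in> lower_terms U f e"
  shows "x * y \<in> lower_terms U f (d + e)"
proof -
  obtain a where a: "x = (\<Sum>i=1..d. a i * f ^ (d - i))" "\<forall>i\<in>{1..d}. a i \<in> mono_span (npow U i)"
    using assms by (auto simp: lower_terms_def)
  obtain b where b: "y = (\<Sum>i=1..e. b i * f ^ (e - i))" "\<forall>i\<in>{1..e}. b i \<in> mono_span (npow U i)"
    using assms by (auto simp: lower_terms_def)
  have "x * y = (\<Sum>i=1..d. \<Sum>j=1..e. (a i * b j) * f ^ (d + e - (i + j)))"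
    unfolding a(1) b(1) sum_product
  proof (intro sum.cong refl)
    fix i j assume "i \<in> {1..d}" "j \<in> {1..e}"
    then have "d + e - (i + j) = (d - i) + (e - j)" by auto
    then show "a i * f ^ (d - i) * (b j * f ^ (e - j)) = a i * b j * f ^ (d + e - (i + j))"
      by (simp add: power_add mult_ac)
  qed
  also have "\<dots> \<in> lower_terms U f (d + e)"
  proof (intro lower_terms_sum lower_terms_gen)
    fix i j assume ij: "i \<in> {1..d}" "j \<in> {1..e}"
    then show "i + j \<in> {1..d + e}" by auto
    show "a i * b j \<in> mono_span (npow U (i + j))"
      by (rule mono_span_npow_mult[OF up]) (use a(2) b(2) ij in auto)
  qed
  finally show ?thesis .
qed

text \<open>
  This takes the place of the Cayley--Hamilton theorem. A homogeneous linear system with a nowhere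
  vanishing solution is reduced to a single equation by elimination of one unknown at a time. The
  elimination is done without division: the two products that are subtracted have degree \<open>d + d\<close>, and
  the shape of the matrix, \<open>f ^ d\<close> on the diagonal up to lower terms, is preserved.
\<close>

lemma integral_equation_by_elimination:
  fixes f :: "('n::linorder, 'k::field) mpoly"
  assumes up: "up_closed U" and "finite L" "L \<noteq> {}"
    and "d \<ge> 1"
    and "\<And>l. l \<in> L \<Longrightarrow> (\<Sum>j\<in>L. M l j * v j) = 0"
    and "\<And>l. l \<in> L \<Longrightarrow> v l \<noteq> 0"
    and "\<And>l j. l \<in> L \<Longrightarrow> j \<in> L \<Longrightarrow> M l j - (if l = j then f ^ d else 0) \<in> lower_terms U f d"
  shows "\<exists>D\<ge>1. \<exists>y\<in>lower_terms U f D. f ^ D + y = 0"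
  using assms(2-)
proof (induction L arbitrary: d M rule: finite_ne_induct)
  case (singleton l)
  have "M l l * v l = 0" "v l \<noteq> 0" using singleton(2,3)[of l] by auto
  then have "M l l = 0" by simp
  then show ?case
    using singleton(1) singleton(4)[of l l] by (intro exI[of _ d] conjI bexI[of _ "- (f ^ d)"]) auto
next
  case (insert n L)
  \<comment> \<open>eliminate the unknown \<open>v n\<close>\<close>
  define M' where "M' l j = M n n * M l j - M l n * M n j" for l j
  define N where "N l j = M l j - (if l = j then f ^ d else 0)" for l j
  have N: "N l j \<in> lower_terms U f d" if "l \<in> insert n L" "j \<in> insert n L" for l j
    unfolding N_def using insert.prems(4)[OF that] .
  show ?case
  proof (rule insert.IH[of "d + d" M'])
    show "d + d \<ge> 1" using insert.prems(1) by simp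
  next
    fix l assume l: "l \<in> L"
    have e: "(\<Sum>j\<in>L. M i j * v j) = - (M i n * v n)" if "i \<in> insert n L" for i
      using insert.prems(2)[OF that] insert.hyps by (simp add: eq_neg_iff_add_eq_0 add.commute)
    have "(\<Sum>j\<in>L. M' l j * v j) = M n n * (\<Sum>j\<in>L. M l j * v j) - M l n * (\<Sum>j\<in>L. M n j * v j)"
      by (simp add: M'_def left_diff_distrib sum_subtractf sum_distrib_left mult.assoc)
    also have "\<dots> = 0" using e[of l] e[of n] l by (simp add: algebra_simps)
    finally show "(\<Sum>j\<in>L. M' l j * v j) = 0" .
  next
    fix l assume "l \<in> L"
    then show "v l \<noteq> 0" using insert.prems(3) by simp
  next
    fix l j assume lj: "l \<in> L" "j \<in> L"
    then have nn: "l \<noteq> n" "j \<noteq> n" using insert.hyps by auto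
    define \<delta> where "\<delta> = (if l = j then 1 else 0 :: ('n, 'k) mpoly)"
    have "M n n = f ^ d + N n n" "M l j = \<delta> * f ^ d + N l j" "M l n = N l n" "M n j = N n j"
      using nn by (auto simp: N_def \<delta>_def)
    then have "M' l j - (if l = j then f ^ (d + d) else 0) =
        f ^ d * N l j + (if l = j then f ^ d * N n n else 0) + N n n * N l j + - (N l n * N n j)"
      by (simp add: M'_def \<delta>_def power_add algebra_simps)
    also have "\<dots> \<in> lower_terms U f (d + d)"
    proof -
      have "f ^ d * N l j \<in> lower_terms U f (d + d)"
        using lj by (intro lower_terms_power_mult N) auto
      moreover have "f ^ d * N n n \<in> lower_terms U f (d + d)"
        by (intro lower_terms_power_mult N) auto
      then have "(if l = j then f ^ d * N n n else 0) \<in> lower_terms U f (d + d)"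
        by (simp add: lower_terms_0)
      moreover have "N n n * N l j \<in> lower_terms U f (d + d)"
        using lj by (intro lower_terms_mult[OF up] N) auto
      moreover have "N l n * N n j \<in> lower_terms U f (d + d)"
        using lj by (intro lower_terms_mult[OF up] N) auto
      ultimately show ?thesis by (intro lower_terms_add lower_terms_uminus)
    qed
    finally show "M' l j - (if l = j then f ^ (d + d) else 0) \<in> lower_terms U f (d + d)" .
  qed
qed

lemma common_multiple_newton_closure:
  assumes up: "up_closed U" and "finite Z" "Z \<subseteq> newton_closure U"
  obtains N where "N \<ge> 1" "\<And>u. u \<in> Z \<Longrightarrow> nmul N u \<in> npow U N"
proof -
  have "\<exists>N\<ge>1. \<forall>u\<in>Z. nmul N u \<in> npow U N"
    using assms(2,3)
  proof (induction Z)
    case (insert u Z)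
    then obtain N where N: "N \<ge> 1" "\<forall>u\<in>Z. nmul N u \<in> npow U N" by auto
    obtain m where m: "m \<ge> 1" "\<And>t. nmul (t * m) u \<in> npow U (t * m)"
      using newton_closure_nmul[OF up, of u] insert.prems by auto
    have "nmul (m * N) w \<in> npow U (m * N)" if "w \<in> Z" for w
      using npow_nmul[OF up, of "nmul N w" N m] N(2) that by (simp add: nmul_mult)
    moreover have "nmul (m * N) u \<in> npow U (m * N)" using m(2)[of N] by (simp add: mult.commute)
    ultimately show ?case using N(1) m(1) by (intro exI[of _ "m * N"]) auto
  qed auto
  then show ?thesis using that by blast
qed

lemma sum_nmul_upd:
  assumes "finite Z" "u \<in> Z"
  shows "(\<Sum>w\<in>Z. nmul ((a(u := b)) w) w) + nmul (a u) u = (\<Sum>w\<in>Z. nmul (a w) w) + nmul b u"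
    and "(\<Sum>w\<in>Z. (a(u := b)) w) + a u = (\<Sum>w\<in>Z. a w) + (b::nat)"
proof -
  have "(\<Sum>w\<in>Z - {u}. nmul ((a(u := b)) w) w) = (\<Sum>w\<in>Z - {u}. nmul (a w) w)"
    by (intro sum.cong) auto
  then show "(\<Sum>w\<in>Z. nmul ((a(u := b)) w) w) + nmul (a u) u = (\<Sum>w\<in>Z. nmul (a w) w) + nmul b u"
    using assms by (simp add: sum.remove[of Z u] add_ac)
  have "(\<Sum>w\<in>Z - {u}. (a(u := b)) w) = (\<Sum>w\<in>Z - {u}. a w)"
    by (intro sum.cong) auto
  then show "(\<Sum>w\<in>Z. (a(u := b)) w) + a u = (\<Sum>w\<in>Z. a w) + (b::nat)"
    using assms by (simp add: sum.remove[of Z u] add_ac)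
qed

text \<open>
  In terms of ideals, \<open>V\<close> is the set of exponents of a nonzero ideal \<open>L\<close> such that \<open>f L\<close> is
  contained in the product of \<open>L\<close> with the ideal of \<open>U\<close>, for every \<open>f\<close> with all exponents in \<open>Z\<close>. It
  is generated by products of \<open>T\<close> factors, of which each exponent in \<open>Z\<close> provides fewer than \<open>N\<close> and
  \<open>U\<close> the remaining ones: as soon as an exponent occurs \<open>N\<close> times, these \<open>N\<close> copies are traded for
  elements of \<open>U\<close>.
\<close>

lemma reduction_set:
  assumes up: "up_closed U" and fin: "finite Z" and ne: "Z \<noteq> {}" and sub: "Z \<subseteq> newton_closure U"
  obtains V where "up_closed V" "V \<noteq> {}" "\<And>u v. u \<in> Z \<Longrightarrow> v \<in> V \<Longrightarrow> u + v \<in> sumset U V"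
proof -
  obtain N where N: "N \<ge> 1" "\<And>u. u \<in> Z \<Longrightarrow> nmul N u \<in> npow U N"
    using common_multiple_newton_closure[OF up fin sub] by blast
  \<comment> \<open>large enough that at least one factor is left for \<open>U\<close>, see \<open>lt\<close> below\<close>
  define T where "T = N * card Z"
  define V where "V = {(\<Sum>w\<in>Z. nmul (a w) w) + \<kappa> |a \<kappa>. (\<forall>w\<in>Z. a w < N) \<and> \<kappa> \<in> npow U (T - (\<Sum>w\<in>Z. a w))}"
  have VI: "(\<Sum>w\<in>Z. nmul (a w) w) + \<kappa> \<in> V"
    if "\<forall>w\<in>Z. a w < N" "\<kappa> \<in> npow U (T - (\<Sum>w\<in>Z. a w))" for a \<kappa>
    using that by (auto simp: V_def)
  show ?thesis
  proof
    show "up_closed V"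
      unfolding up_closed_def
    proof (intro ballI allI)
      fix v w assume "v \<in> V"
      then obtain a \<kappa> where v: "v = (\<Sum>w\<in>Z. nmul (a w) w) + \<kappa>" "\<forall>w\<in>Z. a w < N"
        "\<kappa> \<in> npow U (T - (\<Sum>w\<in>Z. a w))" by (auto simp: V_def)
      show "v + w \<in> V"
        using VI[OF v(2) up_closedD[OF up_closed_npow[OF up] v(3), of w]] by (simp add: v(1) add.assoc)
    qed
    obtain u where "u \<in> Z" using ne by blast
    have "npow U m \<noteq> {}" for m
    proof -
      have "nmul m (nmul N u) \<in> npow U (m * N)" by (rule npow_nmul[OF up N(2)[OF \<open>u \<in> Z\<close>]])
      moreover have "npow U (m * N) \<subseteq> npow U m" by (rule npow_antimono[OF up]) (use N(1) in simp)
      ultimately show ?thesis by blast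
    qed
    then obtain \<kappa> where "\<kappa> \<in> npow U T" by blast
    then show "V \<noteq> {}" using VI[of "\<lambda>_. 0" \<kappa>] N(1) by auto
  next
    fix u v assume u: "u \<in> Z" and "v \<in> V"
    then obtain a \<kappa> where v: "v = (\<Sum>w\<in>Z. nmul (a w) w) + \<kappa>" "\<forall>w\<in>Z. a w < N"
        "\<kappa> \<in> npow U (T - (\<Sum>w\<in>Z. a w))" by (auto simp: V_def)
    have "(\<Sum>w\<in>Z. a w) < (\<Sum>w\<in>Z. N)"
      by (rule sum_strict_mono[OF fin ne]) (use v(2) in auto)
    then have lt: "(\<Sum>w\<in>Z. a w) < T" by (simp add: T_def mult.commute)
    \<comment> \<open>one more factor than needed, with multiplicities still below \<open>N\<close>\<close>
    have "\<exists>b \<xi>. (\<forall>w\<in>Z. b w < N) \<and> \<xi> \<in> npow U (Suc (T - (\<Sum>w\<in>Z. b w))) \<and>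
        u + v = (\<Sum>w\<in>Z. nmul (b w) w) + \<xi>"
    proof (cases "Suc (a u) < N")
      case True
      define b where "b = a(u := Suc (a u))"
      have "(\<Sum>w\<in>Z. nmul (b w) w) + nmul (a u) u = ((\<Sum>w\<in>Z. nmul (a w) w) + u) + nmul (a u) u"
        unfolding b_def using sum_nmul_upd(1)[OF fin u, of a "Suc (a u)"] by (simp add: nmul_Suc add_ac)
      then have "(\<Sum>w\<in>Z. nmul (b w) w) = (\<Sum>w\<in>Z. nmul (a w) w) + u" by simp
      then have "u + v = (\<Sum>w\<in>Z. nmul (b w) w) + \<kappa>" by (simp add: v(1) add_ac)
      moreover have "(\<Sum>w\<in>Z. b w) = Suc (\<Sum>w\<in>Z. a w)"
        unfolding b_def using sum_nmul_upd(2)[OF fin u, of a "Suc (a u)"] by simp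
      then have "Suc (T - (\<Sum>w\<in>Z. b w)) = T - (\<Sum>w\<in>Z. a w)" using lt by simp
      then have "\<kappa> \<in> npow U (Suc (T - (\<Sum>w\<in>Z. b w)))" using v(3) by simp
      moreover have "\<forall>w\<in>Z. b w < N" using v(2) True by (simp add: b_def)
      ultimately show ?thesis by blast
    next
      case False
      then have au: "Suc (a u) = N" using v(2) u by (auto simp: not_less_eq le_less_Suc_eq)
      define b where "b = a(u := 0)"
      have "(\<Sum>w\<in>Z. nmul (b w) w) + nmul (a u) u = (\<Sum>w\<in>Z. nmul (a w) w)"
        unfolding b_def using sum_nmul_upd(1)[OF fin u, of a 0] by simp
      then have "u + v = (\<Sum>w\<in>Z. nmul (b w) w) + (nmul N u + \<kappa>)"
        by (simp add: v(1) au[symmetric] nmul_Suc add_ac)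
      moreover have "(\<Sum>w\<in>Z. b w) + a u = (\<Sum>w\<in>Z. a w)"
        unfolding b_def using sum_nmul_upd(2)[OF fin u, of a 0] by simp
      then have "Suc (T - (\<Sum>w\<in>Z. b w)) = N + (T - (\<Sum>w\<in>Z. a w))" using lt au by simp
      then have "nmul N u + \<kappa> \<in> npow U (Suc (T - (\<Sum>w\<in>Z. b w)))"
        using npow_add[OF up N(2)[OF u] v(3)] by simp
      moreover have "\<forall>w\<in>Z. b w < N" using v(2) N(1) by (simp add: b_def)
      ultimately show ?thesis by blast
    qed
    then obtain b \<xi> where b: "\<forall>w\<in>Z. b w < N" "\<xi> \<in> npow U (Suc (T - (\<Sum>w\<in>Z. b w)))"
        "u + v = (\<Sum>w\<in>Z. nmul (b w) w) + \<xi>" by blast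
    obtain \<kappa>' x where x: "\<xi> = \<kappa>' + x" "\<kappa>' \<in> npow U (T - (\<Sum>w\<in>Z. b w))" "x \<in> U"
      using b(2) by (auto simp: sumset_def)
    have "u + v = x + ((\<Sum>w\<in>Z. nmul (b w) w) + \<kappa>')" by (simp add: b(3) x(1) add_ac)
    then show "u + v \<in> sumset U V" using x(3) VI[OF b(1) x(2)] unfolding sumset_def by blast
  qed
qed

text \<open>
  Multiplication by \<open>f\<close> maps the finitely many generators of the ideal from lemma \<open>reduction_set\<close> to
  combinations of themselves with coefficients in the ideal of \<open>U\<close>. This is a linear system to which
  the elimination applies.
\<close>

lemma integral_if_keys_in_newton_closure:
  fixes f :: "('n::{finite,linorder}, 'k::field) mpoly"
  assumes up: "up_closed U" and f: "Poly_Mapping.keys f \<subseteq> newton_closure U"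
  shows "f \<in> integral_closure (mono_span U)"
proof (cases "f = 0")
  case True
  then show ?thesis
    unfolding integral_closure_def by (auto intro!: exI[of _ 1] exI[of _ "\<lambda>_. 0"] simp: ideal_power_mono_span)
next
  case False
  define Z where "Z = Poly_Mapping.keys f"
  have Z: "finite Z" "Z \<noteq> {}" "Z \<subseteq> newton_closure U" using False f by (auto simp: Z_def)
  obtain V where V: "up_closed V" "V \<noteq> {}" "\<And>u v. u \<in> Z \<Longrightarrow> v \<in> V \<Longrightarrow> u + v \<in> sumset U V"
    using reduction_set[OF up Z] by blast
  obtain L where L: "finite L" "V = upset L" by (rule upset_finite_basis_eq[OF V(1)])
  have "L \<noteq> {}" using V(2) L(2) by (auto simp: upset_def)
  have "\<exists>x j. x \<in> U \<and> j \<in> L \<and> u + l = x + j" if "u \<in> Z" "l \<in> L" for u l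
  proof -
    have "l \<in> V" using that(2) upset_superset unfolding L(2) by blast
    from V(3)[OF that(1) this] obtain x v where xv: "u + l = x + v" "x \<in> U" "v \<in> V"
      by (auto simp: sumset_def)
    obtain j w where "v = j + w" "j \<in> L" using xv(3) by (auto simp: L(2) upset_def)
    then show ?thesis using xv up_closedD[OF up xv(2), of w]
      by (intro exI[of _ "x + w"] exI[of _ j]) (auto simp: add_ac)
  qed
  then obtain x j where xj: "\<And>u l. u \<in> Z \<Longrightarrow> l \<in> L \<Longrightarrow> x u l \<in> U \<and> j u l \<in> L \<and> u + l = x u l + j u l"
    by metis
  define k where "k l i = (\<Sum>u\<in>{u \<in> Z. j u l = i}. Poly_Mapping.single (x u l) (Poly_Mapping.lookup f u))" for l i
  have k: "k l i \<in> mono_span U" if "l \<in> L" for l i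
    unfolding k_def using that xj by (intro mono_span_sum single_in_mono_span) auto
  have fl: "f * monomial l = (\<Sum>i\<in>L. k l i * monomial i)" if l: "l \<in> L" for l
  proof -
    have "f * monomial l = (\<Sum>u\<in>Z. Poly_Mapping.single u (Poly_Mapping.lookup f u)) * monomial l"
      using mpoly_eq_sum_single[of f] by (simp add: Z_def)
    also have "\<dots> = (\<Sum>u\<in>Z. Poly_Mapping.single (u + l) (Poly_Mapping.lookup f u))"
      by (simp add: sum_distrib_right monomial_def mult_single)
    also have "\<dots> = (\<Sum>u\<in>Z. Poly_Mapping.single (x u l) (Poly_Mapping.lookup f u) * monomial (j u l))"
      using xj l by (intro sum.cong) (auto simp: monomial_def mult_single)
    also have "\<dots> = (\<Sum>i\<in>L. \<Sum>u\<in>{u \<in> Z. j u l = i}. Poly_Mapping.single (x u l) (Poly_Mapping.lookup f u) * monomial (j u l))"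
      by (rule sum.group[symmetric]) (use Z L xj l in auto)
    also have "\<dots> = (\<Sum>i\<in>L. k l i * monomial i)"
      unfolding k_def sum_distrib_right by (intro sum.cong) auto
    finally show ?thesis .
  qed
  have "\<exists>D\<ge>1. \<exists>y\<in>lower_terms U f D. f ^ D + y = 0"
  proof (rule integral_equation_by_elimination[OF up L(1) \<open>L \<noteq> {}\<close>, of 1])
    fix l assume l: "l \<in> L"
    have "(\<Sum>i\<in>L. ((if l = i then f else 0) - k l i) * monomial i)
       = (\<Sum>i\<in>L. if l = i then f * monomial i else 0) - (\<Sum>i\<in>L. k l i * monomial i)"
      unfolding sum_subtractf[symmetric] by (intro sum.cong) (auto simp: left_diff_distrib)
    also have "\<dots> = 0" using fl[OF l] l L(1) by simp
    finally show "(\<Sum>i\<in>L. ((if l = i then f else 0) - k l i) * monomial i) = 0" .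
    show "monomial l \<noteq> (0 :: ('n, 'k) mpoly)" by (metis monomial_def lookup_single_eq lookup_zero zero_neq_one)
    fix i assume "i \<in> L"
    have "- k l i \<in> lower_terms U f 1"
    proof -
      have "- k l i \<in> mono_span (npow U 1)"
        unfolding One_nat_def npow_Suc_0[OF up] by (intro mono_span_uminus k l)
      then show ?thesis using lower_terms_gen[of 1 1 "- k l i" U f] by simp
    qed
    then show "((if l = i then f else 0) - k l i) - (if l = i then f ^ 1 else 0) \<in> lower_terms U f 1"
      by (cases "l = i") simp_all
  qed simp
  then show ?thesis
    unfolding integral_closure_def ideal_power_mono_span lower_terms_def by auto
qed

lemma integral_closure_mono_span:
  fixes U :: "('n::{finite,linorder} \<Rightarrow>\<^sub>0 nat) set"
  assumes "up_closed U"
  shows "integral_closure (mono_span U) = (mono_span (newton_closure U) :: ('n, 'k::field) mpoly set)"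
  using integral_if_keys_in_newton_closure[OF assms] keys_almost_integral[OF assms integral_imp_almost_integral[OF assms]]
  by (auto simp: mono_span_def[of "newton_closure U"])

section \<open>Quotient modules\<close>

lemma quot_module_sel [simp]:
  "carrier (quot_module M N) = a_rcosets\<^bsub>M\<^esub> N"
  "ring.add (quot_module M N) = set_add M"
  "ring.zero (quot_module M N) = N"
  "a \<odot>\<^bsub>quot_module M N\<^esub> S = (\<Union>x\<in>S. N +>\<^bsub>M\<^esub> (a \<odot>\<^bsub>M\<^esub> x))"
  by (simp_all add: quot_module_def FactRing_def ring.extend_def module.fields_def)

lemma ideal_module_sel [simp]:
  "carrier (ideal_module A) = A"
  "ring.add (ideal_module A) = (+)"
  "ring.zero (ideal_module A) = 0"
  "f \<odot>\<^bsub>ideal_module A\<^esub> g = f * g"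
  by (simp_all add: ideal_module_def ring.extend_def module.fields_def ring_of_type_algebra_def fun_eq_iff)

lemma carrier_quot_module: "carrier (quot_module M N) = (\<lambda>x. N +>\<^bsub>M\<^esub> x) ` carrier M"
  by (auto simp: A_RCOSETS_def')

context
  fixes R :: "('a, 'b) ring_scheme" and M :: "('a, 'v) module" and N
  assumes M: "module R M" and N: "submodule N R M"
begin

interpretation module R M by (rule M)

interpretation sub: abelian_subgroup N M
  using submodule.axioms(1)[OF N] M.abelian_group_axioms
  by (intro abelian_subgroupI3 additive_subgroup.intro)

lemma quot_module_add:
  assumes "x \<in> carrier M" "y \<in> carrier M"
  shows "(N +>\<^bsub>M\<^esub> x) \<oplus>\<^bsub>quot_module M N\<^esub> (N +>\<^bsub>M\<^esub> y) = N +>\<^bsub>M\<^esub> (x \<oplus>\<^bsub>M\<^esub> y)"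
  using sub.a_rcos_sum[OF assms] by simp

lemma quot_module_zero_iff:
  assumes "x \<in> carrier M"
  shows "N +>\<^bsub>M\<^esub> x = \<zero>\<^bsub>quot_module M N\<^esub> \<longleftrightarrow> x \<in> N"
  using sub.a_rcos_self[OF assms] sub.a_rcos_const by auto

lemma quot_module_smult:
  assumes a: "a \<in> carrier R" and x: "x \<in> carrier M"
  shows "a \<odot>\<^bsub>quot_module M N\<^esub> (N +>\<^bsub>M\<^esub> x) = N +>\<^bsub>M\<^esub> (a \<odot>\<^bsub>M\<^esub> x)"
proof -
  have "N +>\<^bsub>M\<^esub> (a \<odot>\<^bsub>M\<^esub> y) = N +>\<^bsub>M\<^esub> (a \<odot>\<^bsub>M\<^esub> x)" if y: "y \<in> N +>\<^bsub>M\<^esub> x" for y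
  proof -
    obtain h where h: "h \<in> N" "y = h \<oplus>\<^bsub>M\<^esub> x" using y by (auto simp: a_r_coset_def r_coset_def)
    have "a \<odot>\<^bsub>M\<^esub> h \<in> N" using submodule.smult_closed[OF N a h(1)] .
    moreover have "a \<odot>\<^bsub>M\<^esub> y = a \<odot>\<^bsub>M\<^esub> h \<oplus>\<^bsub>M\<^esub> a \<odot>\<^bsub>M\<^esub> x"
      using h a x sub.a_subset by (auto simp: smult_r_distr)
    ultimately have "a \<odot>\<^bsub>M\<^esub> y \<in> N +>\<^bsub>M\<^esub> (a \<odot>\<^bsub>M\<^esub> x)" by (auto simp: a_r_coset_def r_coset_def)
    then show ?thesis
      using sub.a_repr_independence'[of "a \<odot>\<^bsub>M\<^esub> y" "a \<odot>\<^bsub>M\<^esub> x"] a x by auto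
  qed
  then have "(\<Union>y\<in>N +>\<^bsub>M\<^esub> x. N +>\<^bsub>M\<^esub> (a \<odot>\<^bsub>M\<^esub> y)) = (\<Union>y\<in>N +>\<^bsub>M\<^esub> x. N +>\<^bsub>M\<^esub> (a \<odot>\<^bsub>M\<^esub> x))"
    by (intro SUP_cong) simp_all
  also have "\<dots> = N +>\<^bsub>M\<^esub> (a \<odot>\<^bsub>M\<^esub> x)"
    using sub.a_rcos_self[OF x] by (subst UN_constant) auto
  finally show ?thesis unfolding quot_module_sel .
qed

lemma module_quot_module: "module R (quot_module M N)"
proof (rule moduleI)
  show "cring R" by (rule module.axioms(1)[OF M])
  let ?Q = "quot_module M N"
  have N0: "\<zero>\<^bsub>?Q\<^esub> = N +>\<^bsub>M\<^esub> \<zero>\<^bsub>M\<^esub>"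
    using quot_module_zero_iff[of "\<zero>\<^bsub>M\<^esub>"] sub.zero_closed by simp
  have rep: "\<exists>x\<in>carrier M. S = N +>\<^bsub>M\<^esub> x" if "S \<in> carrier ?Q" for S
    using that unfolding carrier_quot_module by blast
  have car: "N +>\<^bsub>M\<^esub> x \<in> carrier ?Q" if "x \<in> carrier M" for x
    using that unfolding carrier_quot_module by blast
  note s = quot_module_smult quot_module_add
  show "abelian_group ?Q"
  proof (rule abelian_groupI)
    show "\<zero>\<^bsub>?Q\<^esub> \<in> carrier ?Q" unfolding N0 by (rule car) simp
    fix S assume "S \<in> carrier ?Q"
    then obtain x where S: "S = N +>\<^bsub>M\<^esub> x" "x \<in> carrier M" using rep by blast
    show "\<zero>\<^bsub>?Q\<^esub> \<oplus>\<^bsub>?Q\<^esub> S = S"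
      using S(2) unfolding N0 S(1) by (simp del: quot_module_sel add: s)
    have "(N +>\<^bsub>M\<^esub> (\<ominus>\<^bsub>M\<^esub> x)) \<oplus>\<^bsub>?Q\<^esub> S = \<zero>\<^bsub>?Q\<^esub>"
      using S(2) unfolding N0 S(1) by (simp del: quot_module_sel add: s M.l_neg)
    then show "\<exists>T\<in>carrier ?Q. T \<oplus>\<^bsub>?Q\<^esub> S = \<zero>\<^bsub>?Q\<^esub>" using car[of "\<ominus>\<^bsub>M\<^esub> x"] S(2) by blast
    fix T assume "T \<in> carrier ?Q"
    then obtain y where T: "T = N +>\<^bsub>M\<^esub> y" "y \<in> carrier M" using rep by blast
    show "S \<oplus>\<^bsub>?Q\<^esub> T \<in> carrier ?Q"
      unfolding S(1) T(1) quot_module_add[OF S(2) T(2)] by (rule car) (use S T in simp)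
    show "S \<oplus>\<^bsub>?Q\<^esub> T = T \<oplus>\<^bsub>?Q\<^esub> S"
      using S(2) T(2) unfolding S(1) T(1) by (simp del: quot_module_sel add: s M.a_comm)
    fix U assume "U \<in> carrier ?Q"
    then obtain z where U: "U = N +>\<^bsub>M\<^esub> z" "z \<in> carrier M" using rep by blast
    show "(S \<oplus>\<^bsub>?Q\<^esub> T) \<oplus>\<^bsub>?Q\<^esub> U = S \<oplus>\<^bsub>?Q\<^esub> (T \<oplus>\<^bsub>?Q\<^esub> U)"
      using S(2) T(2) U(2) unfolding S(1) T(1) U(1) by (simp del: quot_module_sel add: s M.a_assoc)
  qed
  fix a S assume a: "a \<in> carrier R" and "S \<in> carrier ?Q"
  then obtain x where S: "S = N +>\<^bsub>M\<^esub> x" "x \<in> carrier M" using rep by blast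
  show "a \<odot>\<^bsub>?Q\<^esub> S \<in> carrier ?Q"
    unfolding S(1) quot_module_smult[OF a S(2)] by (rule car) (use a S(2) in simp)
  { fix b assume b: "b \<in> carrier R"
    show "(a \<oplus>\<^bsub>R\<^esub> b) \<odot>\<^bsub>?Q\<^esub> S = a \<odot>\<^bsub>?Q\<^esub> S \<oplus>\<^bsub>?Q\<^esub> b \<odot>\<^bsub>?Q\<^esub> S"
      using a b S(2) unfolding S(1) by (simp del: quot_module_sel add: s smult_l_distr)
    show "(a \<otimes>\<^bsub>R\<^esub> b) \<odot>\<^bsub>?Q\<^esub> S = a \<odot>\<^bsub>?Q\<^esub> (b \<odot>\<^bsub>?Q\<^esub> S)"
      using a b S(2) unfolding S(1) by (simp del: quot_module_sel add: s smult_assoc1) }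
  { fix T assume "T \<in> carrier ?Q"
    then obtain y where T: "T = N +>\<^bsub>M\<^esub> y" "y \<in> carrier M" using rep by blast
    show "a \<odot>\<^bsub>?Q\<^esub> (S \<oplus>\<^bsub>?Q\<^esub> T) = a \<odot>\<^bsub>?Q\<^esub> S \<oplus>\<^bsub>?Q\<^esub> a \<odot>\<^bsub>?Q\<^esub> T"
      using a S(2) T(2) unfolding S(1) T(1) by (simp del: quot_module_sel add: s smult_r_distr) }
next
  fix S assume "S \<in> carrier (quot_module M N)"
  then obtain x where S: "S = N +>\<^bsub>M\<^esub> x" "x \<in> carrier M" unfolding carrier_quot_module by blast
  show "\<one>\<^bsub>R\<^esub> \<odot>\<^bsub>quot_module M N\<^esub> S = S"
    using S(2) unfolding S(1) by (simp del: quot_module_sel add: quot_module_smult)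
qed

end

lemma module_ideal_module:
  assumes "ideal A mpoly_ring"
  shows "module mpoly_ring (ideal_module (A :: ('n, 'k::field) mpoly set))"
proof (rule moduleI)
  show "cring (mpoly_ring :: ('n, 'k) mpoly ring)" by (rule cring_mpoly_ring)
  note A = ideal_mpoly_ringD[OF assms]
  show "abelian_group (ideal_module A)"
  proof (rule abelian_groupI)
    fix x assume "x \<in> carrier (ideal_module A)"
    then show "\<exists>y\<in>carrier (ideal_module A). y \<oplus>\<^bsub>ideal_module A\<^esub> x = \<zero>\<^bsub>ideal_module A\<^esub>"
      using A(3)[of x "- 1"] by (intro bexI[of _ "- x"]) auto
  qed (use A in \<open>auto simp: algebra_simps\<close>)
  show "a \<odot>\<^bsub>ideal_module A\<^esub> x \<in> carrier (ideal_module A)" if "x \<in> carrier (ideal_module A)" for a x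
    using A(3)[of x a] that by simp
qed (auto simp: algebra_simps)

lemma submodule_ideal_module:
  assumes "ideal A mpoly_ring" "ideal B mpoly_ring" "B \<subseteq> A"
  shows "submodule B mpoly_ring (ideal_module (A :: ('n, 'k::field) mpoly set))"
proof -
  interpret module mpoly_ring "ideal_module A" by (rule module_ideal_module[OF assms(1)])
  note B = ideal_mpoly_ringD[OF assms(2)]
  show ?thesis
  proof (rule submoduleI)
    fix x assume x: "x \<in> B"
    have "\<ominus>\<^bsub>ideal_module A\<^esub> x = - x"
      using x assms(3) B(3)[of x "- 1"] by (intro M.minus_equality) auto
    then show "\<ominus>\<^bsub>ideal_module A\<^esub> x \<in> B" using B(3)[of x "- 1"] x by simp
  qed (use assms(3) B in auto)
qed

lemma submodule_ideal_times_module: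
  assumes "module mpoly_ring (M :: (('n, 'k::field) mpoly, 'v) module)"
  shows "submodule (ideal_times_module J M) mpoly_ring M"
proof -
  interpret module mpoly_ring M by fact
  define F where "F = {N. submodule N (mpoly_ring :: ('n, 'k) mpoly ring) M \<and> (\<forall>a\<in>J. \<forall>x\<in>carrier M. a \<odot>\<^bsub>M\<^esub> x \<in> N)}"
  have eq: "ideal_times_module J M = \<Inter>F" by (simp add: ideal_times_module_def F_def)
  have sub: "submodule N (mpoly_ring :: ('n, 'k) mpoly ring) M" if "N \<in> F" for N using that unfolding F_def by blast
  have car: "carrier M \<in> F" using carrier_is_submodule by (auto simp: F_def)
  show ?thesis
    unfolding eq
  proof (rule submoduleI)
    show "\<Inter>F \<subseteq> carrier M" using car by blast
    show "\<zero>\<^bsub>M\<^esub> \<in> \<Inter>F"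
    proof
      fix N assume "N \<in> F"
      then have "subgroup N (add_monoid M)" by (rule submodule.axioms(1)[OF sub])
      from subgroup.one_closed[OF this] show "\<zero>\<^bsub>M\<^esub> \<in> N" by simp
    qed
  qed (use submoduleE[OF sub] in auto)
qed

section \<open>The number of generators of a quotient of monomial ideals\<close>

text \<open>
  The dimension is the size of an arbitrarily chosen basis. So it has to be shown that a basis
  exists, namely the images of the monomials with exponents in \<open>U - T\<close>, and that no basis is larger.
  For the latter, a basis is lifted to linearly independent polynomials in the span of these
  monomials.
\<close>

lemma k_dim_le_card:
  fixes V :: "(('n, 'k::field) mpoly, 'v) module" and p :: "('n, 'k) mpoly \<Rightarrow> 'v"
  assumes V: "module mpoly_ring V"
    and fin: "finite (U - T)" and TU: "T \<subseteq> U"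
    and surj: "carrier V = p ` mono_span U"
    and add: "\<And>f g. f \<in> mono_span U \<Longrightarrow> g \<in> mono_span U \<Longrightarrow> p (f + g) = p f \<oplus>\<^bsub>V\<^esub> p g"
    and smult: "\<And>c f. f \<in> mono_span U \<Longrightarrow> p (mconst c * f) = mconst c \<odot>\<^bsub>V\<^esub> p f"
    and ker: "\<And>f. f \<in> mono_span U \<Longrightarrow> p f = \<zero>\<^bsub>V\<^esub> \<longleftrightarrow> f \<in> mono_span T"
  shows "k_dim V \<le> enat (card (U - T))"
proof -
  interpret V: module mpoly_ring V by (rule V)
  define S where "S = U - T"
  let ?A = "mono_span U :: ('n, 'k) mpoly set"
  have pcl: "p f \<in> carrier V" if "f \<in> ?A" for f using surj that by blast
  have scl: "mconst c * f \<in> ?A" if "f \<in> ?A" for c f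
    using that by (auto simp: mono_span_def in_keys_iff)
  \<comment> \<open>the coefficients at exponents in \<open>S\<close> serve as coordinates on \<open>V\<close>\<close>
  have p_eq: "p f = p g \<longleftrightarrow> (\<forall>u\<in>S. Poly_Mapping.lookup f u = Poly_Mapping.lookup g u)"
    if f: "f \<in> ?A" and g: "g \<in> ?A" for f g
  proof -
    have fg: "f - g \<in> ?A" by (rule mono_span_diff[OF f g])
    have "p f = p (f - g) \<oplus>\<^bsub>V\<^esub> p g" using add[OF fg g] by simp
    then have "p f = p g \<longleftrightarrow> p (f - g) = \<zero>\<^bsub>V\<^esub>"
      using pcl[OF f] pcl[OF g] pcl[OF fg] V.M.add.l_cancel_one'[of "p g" "p (f - g)"]
      by (metis V.M.add.r_cancel_one')
    also have "\<dots> \<longleftrightarrow> f - g \<in> mono_span T" by (rule ker[OF fg])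
    also have "\<dots> \<longleftrightarrow> (\<forall>u\<in>S. Poly_Mapping.lookup f u = Poly_Mapping.lookup g u)"
      using fg by (auto simp: mono_span_def S_def in_keys_iff lookup_minus subset_iff)
    finally show ?thesis .
  qed
  define r where "r b = (SOME f. f \<in> ?A \<and> p f = b)" for b
  have r: "r b \<in> ?A \<and> p (r b) = b" if "b \<in> carrier V" for b
  proof -
    have "\<exists>f. f \<in> ?A \<and> p f = b" using that surj by auto
    then show ?thesis unfolding r_def by (rule someI_ex)
  qed
  have p0: "p 0 = \<zero>\<^bsub>V\<^esub>" using ker[of 0] by simp
  have fs: "(\<Oplus>\<^bsub>V\<^esub>b\<in>B. mconst (c b) \<odot>\<^bsub>V\<^esub> b) = p (\<Sum>b\<in>B. mconst (c b) * r b) \<and> (\<Sum>b\<in>B. mconst (c b) * r b) \<in> ?A"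
    if "finite B" "B \<subseteq> carrier V" for B c
    using that
  proof (induction B)
    case empty
    then show ?case by (simp add: p0)
  next
    case (insert b B)
    then have IH: "(\<Oplus>\<^bsub>V\<^esub>b\<in>B. mconst (c b) \<odot>\<^bsub>V\<^esub> b) = p (\<Sum>b\<in>B. mconst (c b) * r b)"
      "(\<Sum>b\<in>B. mconst (c b) * r b) \<in> ?A" by auto
    have rb: "r b \<in> ?A" "p (r b) = b" using r[of b] insert.prems by auto
    have "(\<Oplus>\<^bsub>V\<^esub>b\<in>insert b B. mconst (c b) \<odot>\<^bsub>V\<^esub> b) =
        mconst (c b) \<odot>\<^bsub>V\<^esub> b \<oplus>\<^bsub>V\<^esub> (\<Oplus>\<^bsub>V\<^esub>b\<in>B. mconst (c b) \<odot>\<^bsub>V\<^esub> b)"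
      using insert by (intro V.M.finsum_insert) auto
    also have "mconst (c b) \<odot>\<^bsub>V\<^esub> b = p (mconst (c b) * r b)"
      using smult[OF rb(1), of "c b"] rb(2) by simp
    finally show ?case
      using insert.hyps IH add[OF scl[OF rb(1)] IH(2)] mono_span_add[OF scl[OF rb(1)] IH(2)] by simp
  qed
  have fs_eq: "p f = (\<Oplus>\<^bsub>V\<^esub>b\<in>B. mconst (c b) \<odot>\<^bsub>V\<^esub> b) \<longleftrightarrow>
      (\<forall>u\<in>S. Poly_Mapping.lookup f u = (\<Sum>b\<in>B. c b * Poly_Mapping.lookup (r b) u))"
    if "finite B" "B \<subseteq> carrier V" "f \<in> ?A" for f B c
    using fs[OF that(1,2), of c] p_eq[OF that(3), of "\<Sum>b\<in>B. mconst (c b) * r b"]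
    by (simp add: lookup_sum)
  have ex: "k_basis V ((\<lambda>u. p (monomial u)) ` S)"
  proof -
    define m where "m u = p (monomial u)" for u
    define B where "B = m ` S"
    have mS: "m u \<in> carrier V" if "u \<in> S" for u using that by (auto simp: m_def S_def intro!: pcl)
    have rm: "Poly_Mapping.lookup (r (m u)) w = (if w = u then 1 else 0)" if "u \<in> S" "w \<in> S" for u w
    proof -
      have "p (r (m u)) = p (monomial u)" using r[OF mS[OF that(1)]] by (simp add: m_def)
      then have "Poly_Mapping.lookup (r (m u)) w = Poly_Mapping.lookup (monomial u :: ('n,'k) mpoly) w"
        using p_eq[of "r (m u)" "monomial u"] r[OF mS[OF that(1)]] that by (simp add: S_def)
      then show ?thesis by (simp add: monomial_def lookup_single when_def)
    qed
    have inj: "inj_on m S"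
    proof (rule inj_onI)
      fix u w assume "u \<in> S" "w \<in> S" "m u = m w"
      then show "u = w" using rm[of u u] rm[of w u] by (auto split: if_splits)
    qed
    have finB: "finite B" using fin by (simp add: B_def S_def)
    have sums: "(\<Sum>b\<in>{b. c b \<noteq> 0}. c b * Poly_Mapping.lookup (r b) w) = c (m w)"
      if "{b. c b \<noteq> 0} \<subseteq> B" "w \<in> S" for c w
    proof -
      have "(\<Sum>b\<in>{b. c b \<noteq> 0}. c b * Poly_Mapping.lookup (r b) w) = (\<Sum>b\<in>B. c b * Poly_Mapping.lookup (r b) w)"
        using that finB by (intro sum.mono_neutral_left) auto
      also have "\<dots> = (\<Sum>u\<in>S. c (m u) * Poly_Mapping.lookup (r (m u)) w)"
        unfolding B_def by (subst sum.reindex[OF inj]) simp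
      also have "\<dots> = (\<Sum>u\<in>S. if u = w then c (m w) else 0)"
        using rm that(2) by (intro sum.cong) auto
      also have "\<dots> = c (m w)" using that(2) fin by (simp add: S_def)
      finally show ?thesis .
    qed
    have "k_basis V B"
      unfolding k_basis_def
    proof (intro conjI ballI)
      show BV: "B \<subseteq> carrier V" using mS by (auto simp: B_def)
      fix v assume "v \<in> carrier V"
      then obtain f where f: "v = p f" "f \<in> ?A" using surj by blast
      have iff: "finite {b. c b \<noteq> 0} \<and> {b. c b \<noteq> 0} \<subseteq> B \<and>
          v = (\<Oplus>\<^bsub>V\<^esub>b\<in>{b. c b \<noteq> 0}. mconst (c b) \<odot>\<^bsub>V\<^esub> b) \<longleftrightarrow>
          {b. c b \<noteq> 0} \<subseteq> B \<and> (\<forall>u\<in>S. Poly_Mapping.lookup f u = c (m u))" for c :: "'v \<Rightarrow> 'k"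
      proof (cases "{b. c b \<noteq> 0} \<subseteq> B")
        case True
        then have "finite {b. c b \<noteq> 0}" using finB by (rule finite_subset)
        then show ?thesis
          using fs_eq[of "{b. c b \<noteq> 0}" f c] f True BV sums[OF True] by auto
      qed auto
      show "\<exists>!c. finite {b. c b \<noteq> 0} \<and> {b. c b \<noteq> 0} \<subseteq> B \<and>
          v = (\<Oplus>\<^bsub>V\<^esub>b\<in>{b. c b \<noteq> 0}. mconst (c b) \<odot>\<^bsub>V\<^esub> b)"
        unfolding iff
      proof (rule ex1I[of _ "\<lambda>b. if b \<in> B then Poly_Mapping.lookup f (inv_into S m b) else 0"])
        show "{b. (if b \<in> B then Poly_Mapping.lookup f (inv_into S m b) else 0) \<noteq> 0} \<subseteq> B \<and>
          (\<forall>u\<in>S. Poly_Mapping.lookup f u = (if m u \<in> B then Poly_Mapping.lookup f (inv_into S m (m u)) else 0))"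
          using inj by (auto simp: B_def)
        fix c assume c: "{b. c b \<noteq> 0} \<subseteq> B \<and> (\<forall>u\<in>S. Poly_Mapping.lookup f u = c (m u))"
        show "c = (\<lambda>b. if b \<in> B then Poly_Mapping.lookup f (inv_into S m b) else 0)"
        proof
          fix b
          show "c b = (if b \<in> B then Poly_Mapping.lookup f (inv_into S m b) else 0)"
            using c inj by (auto simp: B_def)
        qed
      qed
    qed
    then show ?thesis by (simp add: B_def m_def)
  qed
  have bound: "finite B \<and> card B \<le> card S" if B: "k_basis V B" for B
  proof -
    interpret vs: vector_space "\<lambda>c (f :: ('n, 'k) mpoly). mconst c * f"
    proof
      fix a b :: 'k and f g :: "('n, 'k) mpoly"
      show "mconst a * (f + g) = mconst a * f + mconst a * g" by (rule distrib_left)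
      show "mconst (a + b) * f = mconst a * f + mconst b * f"
        by (simp add: mconst_def single_add distrib_right)
      show "mconst a * (mconst b * f) = mconst (a * b) * f"
        by (simp add: mconst_def mult_single flip: mult.assoc)
      show "mconst 1 * f = f" by (simp add: mconst_def)
    qed
    have BV: "B \<subseteq> carrier V" using B by (simp add: k_basis_def)
    define s where "s b = (\<Sum>u\<in>S. Poly_Mapping.single u (Poly_Mapping.lookup (r b) u))" for b
    have ls: "Poly_Mapping.lookup (s b) u = Poly_Mapping.lookup (r b) u" if "u \<in> S" for b u
    proof -
      have "(\<Sum>w\<in>S. Poly_Mapping.lookup (Poly_Mapping.single w (Poly_Mapping.lookup (r b) w)) u)
        = (\<Sum>w\<in>S. if w = u then Poly_Mapping.lookup (r b) u else 0)"
        by (intro sum.cong) (auto simp: lookup_single when_def)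
      then show ?thesis using that fin by (simp add: s_def lookup_sum S_def)
    qed
    have inj: "inj_on s B"
    proof (rule inj_onI)
      fix b b' assume bb: "b \<in> B" "b' \<in> B" "s b = s b'"
      then have "\<forall>u\<in>S. Poly_Mapping.lookup (r b) u = Poly_Mapping.lookup (r b') u"
        using ls by metis
      then have "p (r b) = p (r b')" using p_eq r bb(1,2) BV by blast
      then show "b = b'" using r bb(1,2) BV by (metis subsetD)
    qed
    have "vs.independent (s ` B)"
      unfolding vs.independent_explicit_module
    proof (intro allI impI)
      fix t u v assume t: "finite t" "t \<subseteq> s ` B" "(\<Sum>v\<in>t. mconst (u v) * v) = 0" "v \<in> t"
      let ?P = "\<lambda>c :: 'v \<Rightarrow> 'k. finite {b. c b \<noteq> 0} \<and> {b. c b \<noteq> 0} \<subseteq> B \<and>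
          p 0 = (\<Oplus>\<^bsub>V\<^esub>b\<in>{b. c b \<noteq> 0}. mconst (c b) \<odot>\<^bsub>V\<^esub> b)"
      define c where "c b = (if b \<in> B \<and> s b \<in> t then u (s b) else 0)" for b
      define C where "C = {b \<in> B. s b \<in> t}"
      have Ct: "s ` C = t" using t(2) by (auto simp: C_def)
      have injC: "inj_on s C" using inj by (rule inj_on_subset) (auto simp: C_def)
      have finC: "finite C" using t(1) Ct injC by (metis finite_imageD)
      have supp: "{b. c b \<noteq> 0} \<subseteq> C" by (auto simp: c_def C_def)
      then have fsupp: "finite {b. c b \<noteq> 0}" using finC by (rule finite_subset)
      have CB: "C \<subseteq> B" by (auto simp: C_def)
      have "\<forall>w\<in>S. Poly_Mapping.lookup 0 w = (\<Sum>b\<in>{b. c b \<noteq> 0}. c b * Poly_Mapping.lookup (r b) w)"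
      proof
        fix w assume w: "w \<in> S"
        have "(\<Sum>b\<in>{b. c b \<noteq> 0}. c b * Poly_Mapping.lookup (r b) w) = (\<Sum>b\<in>C. c b * Poly_Mapping.lookup (s b) w)"
          using supp finC w by (intro sum.mono_neutral_cong_left) (auto simp: ls)
        also have "\<dots> = (\<Sum>b\<in>C. u (s b) * Poly_Mapping.lookup (s b) w)"
          by (intro sum.cong) (auto simp: c_def C_def)
        also have "\<dots> = (\<Sum>v\<in>t. u v * Poly_Mapping.lookup v w)"
          unfolding Ct[symmetric] by (subst sum.reindex[OF injC]) simp
        also have "\<dots> = Poly_Mapping.lookup (\<Sum>v\<in>t. mconst (u v) * v) w" by (simp add: lookup_sum)
        finally show "Poly_Mapping.lookup 0 w = (\<Sum>b\<in>{b. c b \<noteq> 0}. c b * Poly_Mapping.lookup (r b) w)"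
          using t(3) by simp
      qed
      then have "p 0 = (\<Oplus>\<^bsub>V\<^esub>b\<in>{b. c b \<noteq> 0}. mconst (c b) \<odot>\<^bsub>V\<^esub> b)"
        using fs_eq[OF fsupp, of 0 c] supp CB BV by auto
      then have 1: "?P c" using fsupp supp CB by auto
      have 2: "?P (\<lambda>_. 0)" using p0 by simp
      have "p 0 \<in> carrier V" by (rule pcl) simp
      then have "\<exists>!c. finite {b. c b \<noteq> 0} \<and> {b. c b \<noteq> 0} \<subseteq> B \<and>
          p 0 = (\<Oplus>\<^bsub>V\<^esub>b\<in>{b. c b \<noteq> 0}. mconst (c b) \<odot>\<^bsub>V\<^esub> b)"
        using B unfolding k_basis_def by blast
      then obtain c0 where c0: "\<And>c. ?P c \<Longrightarrow> c = c0" by auto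
      have "c = (\<lambda>_. 0)" using c0[OF 1] c0[OF 2] by simp
      obtain b where b: "b \<in> B" "v = s b" using t(2,4) by blast
      have "c b = u v" using b t(4) by (simp add: c_def)
      then show "u v = 0" using \<open>c = (\<lambda>_. 0)\<close> by simp
    qed
    moreover have "s ` B \<subseteq> vs.span (monomial ` S)"
    proof
      fix f assume "f \<in> s ` B"
      then obtain b where "f = s b" by blast
      then have "f = (\<Sum>u\<in>S. mconst (Poly_Mapping.lookup (r b) u) * monomial u)"
        by (simp add: s_def single_eq_mconst_monomial)
      then show "f \<in> vs.span (monomial ` S)"
        by (auto intro!: vs.span_sum vs.span_scale intro: vs.span_base)
    qed
    moreover have "finite (monomial ` S :: ('n, 'k) mpoly set)" using fin by (simp add: S_def)
    ultimately have *: "finite (s ` B) \<and> card (s ` B) \<le> card (monomial ` S :: ('n, 'k) mpoly set)"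
      by (intro vs.independent_span_bound)
    moreover have "card (monomial ` S :: ('n, 'k) mpoly set) \<le> card S"
      using fin by (intro card_image_le) (simp add: S_def)
    ultimately show ?thesis using inj by (auto simp: finite_image_iff card_image)
  qed
  have "k_basis V (SOME B. k_basis V B)" using ex by (rule someI)
  from bound[OF this] show ?thesis by (simp add: k_dim_def S_def Let_def)
qed

text \<open>
  For an up-closed set \<open>U\<close> these are the exponents of the product of the ideal of \<open>U\<close> with the ideal
  generated by the variables.
\<close>

definition nonminimal :: "('n \<Rightarrow>\<^sub>0 nat) set \<Rightarrow> ('n \<Rightarrow>\<^sub>0 nat) set" where
  "nonminimal U = {u + unit_exp i |u i. u \<in> U}"

text \<open>
  Both the submodule \<open>mono_span V\<close> and the multiples of the variables are spanned by monomials, so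
  that the remaining monomials form a basis of the quotient.
\<close>

lemma num_gens_quot_le:
  fixes U V :: "('n \<Rightarrow>\<^sub>0 nat) set"
  assumes U: "up_closed U" and V: "up_closed V" and VU: "V \<subseteq> U"
    and fin: "finite (U - (nonminimal U \<union> V))"
  shows "num_gens (quot_module (ideal_module (mono_span U :: ('n, 'k::field) mpoly set)) (mono_span V))
     \<le> enat (card (U - (nonminimal U \<union> V)))"
proof -
  let ?R = "mpoly_ring :: ('n, 'k) mpoly ring"
  let ?A = "mono_span U :: ('n, 'k) mpoly set" and ?B = "mono_span V :: ('n, 'k) mpoly set"
  let ?I = "ideal_module ?A"
  define M where "M = quot_module ?I ?B"
  define N where "N = ideal_times_module max_ideal M"
  define T where "T = nonminimal U \<union> V"
  have TU: "T \<subseteq> U" using U VU by (auto simp: T_def nonminimal_def up_closed_def)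
  have BA: "?B \<subseteq> ?A" by (rule mono_span_mono[OF VU])
  have mI: "module ?R ?I" by (rule module_ideal_module[OF ideal_mono_span[OF U]])
  have sB: "submodule ?B ?R ?I"
    by (rule submodule_ideal_module[OF ideal_mono_span[OF U] ideal_mono_span[OF V] BA])
  have mM: "module ?R M" unfolding M_def by (rule module_quot_module[OF mI sB])
  interpret M: module ?R M by (rule mM)
  have sN: "submodule N ?R M" unfolding N_def by (rule submodule_ideal_times_module[OF mM])
  have mQ: "module ?R (quot_module M N)" by (rule module_quot_module[OF mM sN])
  define q where "q f = ?B +>\<^bsub>?I\<^esub> f" for f
  have qcar: "carrier M = q ` ?A" unfolding M_def carrier_quot_module by (simp add: q_def)
  have qcl: "q f \<in> carrier M" if "f \<in> ?A" for f using that qcar by blast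
  have qadd: "q (f + g) = q f \<oplus>\<^bsub>M\<^esub> q g" if "f \<in> ?A" "g \<in> ?A" for f g
    using quot_module_add[OF mI sB, of f g] that unfolding q_def M_def by (simp del: quot_module_sel)
  have qsm: "q (a * f) = a \<odot>\<^bsub>M\<^esub> q f" if "f \<in> ?A" for a f
    using quot_module_smult[OF mI sB, of a f] that unfolding q_def M_def by (simp del: quot_module_sel)
  have q0: "q f = \<zero>\<^bsub>M\<^esub> \<longleftrightarrow> f \<in> ?B" if "f \<in> ?A" for f
    using quot_module_zero_iff[OF mI sB, of f] that unfolding q_def M_def by (simp del: quot_module_sel)
  have Acl: "a * f \<in> ?A" if "f \<in> ?A" for a f by (rule mono_span_mult_left[OF U that])
  have mult_var: "a * f \<in> mono_span (nonminimal U)" if a: "a \<in> max_ideal" and f: "f \<in> ?A"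
    for a f :: "('n, 'k) mpoly"
  proof -
    have "sumset (upset (range unit_exp)) U \<subseteq> nonminimal U"
    proof
      fix x assume "x \<in> sumset (upset (range unit_exp)) U"
      then obtain i w u where x: "x = unit_exp i + w + u" "u \<in> U"
        by (auto simp: sumset_def upset_def)
      have "x = (u + w) + unit_exp i" by (simp add: x(1) add_ac)
      then show "x \<in> nonminimal U" using up_closedD[OF U x(2), of w] unfolding nonminimal_def by blast
    qed
    then show ?thesis using mono_span_mult[OF a[unfolded max_ideal_eq] f] mono_span_mono by blast
  qed
  have qT: "submodule (q ` mono_span T) ?R M"
  proof (rule M.submoduleI)
    show "q ` mono_span T \<subseteq> carrier M" using TU mono_span_mono[OF TU] qcl by blast
    show "\<zero>\<^bsub>M\<^esub> \<in> q ` mono_span T" using q0[of 0] by (metis image_eqI mono_span_0)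
    have TA: "f \<in> ?A" if "f \<in> mono_span T" for f using that mono_span_mono[OF TU] by blast
    { fix x y assume "x \<in> q ` mono_span T" "y \<in> q ` mono_span T"
      then obtain f g where "x = q f" "y = q g" "f \<in> mono_span T" "g \<in> mono_span T" by blast
      then show "x \<oplus>\<^bsub>M\<^esub> y \<in> q ` mono_span T"
        using qadd[of f g] TA mono_span_add[of f T g] by (metis image_eqI) }
    have up: "up_closed T"
      unfolding up_closed_def
    proof (intro ballI allI)
      fix t w assume "t \<in> T"
      then consider "t \<in> V" | u i where "t = u + unit_exp i" "u \<in> U"
        by (auto simp: T_def nonminimal_def)
      then show "t + w \<in> T"
      proof cases
        case 1
        then show ?thesis using up_closedD[OF V] by (simp add: T_def)
      next
        case 2
        then have "t + w = (u + w) + unit_exp i" by (simp add: add_ac)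
        then show ?thesis using up_closedD[OF U 2(2), of w] unfolding T_def nonminimal_def by blast
      qed
    qed
    show sm: "a \<odot>\<^bsub>M\<^esub> x \<in> q ` mono_span T" if "x \<in> q ` mono_span T" for a x
      using that qsm TA mono_span_mult_left[OF up] by (metis (no_types, lifting) image_iff)
    fix x assume x: "x \<in> q ` mono_span T"
    then have xc: "x \<in> carrier M" using TA qcl by blast
    have "\<ominus>\<^bsub>M\<^esub> x = (\<ominus>\<^bsub>?R\<^esub> \<one>\<^bsub>?R\<^esub>) \<odot>\<^bsub>M\<^esub> x"
      using xc M.smult_l_minus[of "\<one>\<^bsub>?R\<^esub>" x] M.smult_one[OF xc] by simp
    then show "\<ominus>\<^bsub>M\<^esub> x \<in> q ` mono_span T" using sm[OF x] by simp
  qed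
  have "(\<forall>a\<in>max_ideal. \<forall>x\<in>carrier M. a \<odot>\<^bsub>M\<^esub> x \<in> q ` mono_span T)"
  proof (intro ballI)
    fix a :: "('n, 'k) mpoly" and x assume a: "a \<in> max_ideal" and "x \<in> carrier M"
    then obtain f where f: "x = q f" "f \<in> ?A" using qcar by blast
    have "a * f \<in> mono_span T" using mult_var[OF a f(2)] mono_span_mono[of "nonminimal U" T] by (auto simp: T_def)
    then show "a \<odot>\<^bsub>M\<^esub> x \<in> q ` mono_span T" using qsm[OF f(2), of a] f(1) by (metis image_eqI)
  qed
  with qT have Nsub: "N \<subseteq> q ` mono_span T" unfolding N_def ideal_times_module_def by blast
  have Nsup: "q f \<in> N" if "f \<in> mono_span T" for f
  proof -
    have Nz: "\<zero>\<^bsub>M\<^esub> \<in> N" using subgroup.one_closed[OF submodule.axioms(1)[OF sN]] by simp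
    have gen: "a \<odot>\<^bsub>M\<^esub> x \<in> N" if "a \<in> max_ideal" "x \<in> carrier M" for a x
      using that unfolding N_def ideal_times_module_def by blast
    have "f \<in> ?A \<and> q f \<in> N" using that
    proof (induction rule: mono_span_induct)
      case zero
      then show ?case using q0[of 0] Nz by simp
    next
      case (add f g)
      then show ?case using qadd[of f g] M.submoduleE(5)[OF sN, of "q f" "q g"] mono_span_add by metis
    next
      case (single t c)
      have tA: "Poly_Mapping.single t c \<in> ?A" using single TU by (intro single_in_mono_span) auto
      consider "t \<in> V" | u i where "t = u + unit_exp i" "u \<in> U"
        using single by (auto simp: T_def nonminimal_def)
      then show ?case
      proof cases
        case 1
        then have "Poly_Mapping.single t c \<in> ?B" by (rule single_in_mono_span)
        then show ?thesis using q0[OF tA] Nz tA by simp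
      next
        case 2
        have uA: "Poly_Mapping.single u c \<in> ?A" using 2 by (intro single_in_mono_span)
        have "Poly_Mapping.single t c = mvar i * Poly_Mapping.single u c"
          by (simp add: 2 mvar_def monomial_def mult_single add.commute)
        moreover have "(mvar i :: ('n, 'k) mpoly) \<in> max_ideal"
          unfolding max_ideal_def by (rule subsetD[OF ring.genideal_self[OF ring_mpoly_ring]]) auto
        ultimately show ?thesis using qsm[OF uA, of "mvar i"] gen[OF _ qcl[OF uA]] tA by metis
      qed
    qed
    then show ?thesis ..
  qed
  define p where "p f = N +>\<^bsub>M\<^esub> (q f)" for f
  have "k_dim (quot_module M N) \<le> enat (card (U - T))"
  proof (rule k_dim_le_card[OF mQ _ TU, of p])
    show "finite (U - T)" using fin by (simp add: T_def)
    show "carrier (quot_module M N) = p ` ?A"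
      unfolding carrier_quot_module qcar p_def by auto
    show "p (f + g) = p f \<oplus>\<^bsub>quot_module M N\<^esub> p g" if "f \<in> ?A" "g \<in> ?A" for f g
      unfolding p_def qadd[OF that] using quot_module_add[OF mM sN qcl[OF that(1)] qcl[OF that(2)]] by simp
    show "p (mconst c * f) = mconst c \<odot>\<^bsub>quot_module M N\<^esub> p f" if "f \<in> ?A" for f c
      unfolding p_def qsm[OF that] using quot_module_smult[OF mM sN _ qcl[OF that], of "mconst c"]
      by (simp del: quot_module_sel)
    show "p f = \<zero>\<^bsub>quot_module M N\<^esub> \<longleftrightarrow> f \<in> mono_span T" if f: "f \<in> ?A" for f
    proof -
      have "p f = \<zero>\<^bsub>quot_module M N\<^esub> \<longleftrightarrow> q f \<in> N"
        unfolding p_def by (rule quot_module_zero_iff[OF mM sN qcl[OF f]])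
      also have "\<dots> \<longleftrightarrow> f \<in> mono_span T"
      proof
        assume "q f \<in> N"
        then obtain g where g: "q f = q g" "g \<in> mono_span T" using Nsub by blast
        then have gA: "g \<in> ?A" using mono_span_mono[OF TU] by blast
        have fg: "f - g \<in> ?A" by (rule mono_span_diff[OF f gA])
        have "q f = q (f - g) \<oplus>\<^bsub>M\<^esub> q g" using qadd[OF fg gA] by simp
        then have "q (f - g) = \<zero>\<^bsub>M\<^esub>"
          using g(1) qcl[OF f] qcl[OF gA] qcl[OF fg] by (metis M.M.add.r_cancel_one')
        then have "f - g \<in> mono_span T"
          using q0[OF fg] mono_span_mono[of V T] by (auto simp: T_def)
        then show "f \<in> mono_span T" using mono_span_add[OF _ g(2)] by fastforce
      qed (rule Nsup)
      finally show ?thesis .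
    qed
  qed
  then show ?thesis by (simp add: num_gens_def N_def M_def T_def)
qed

section \<open>Saturations\<close>

lemma lookup_unit_exp: "Poly_Mapping.lookup (unit_exp i) k = (if k = i then 1 else 0)"
  by (simp add: lookup_single when_def)

lemma lookup_mult_monomial:
  fixes f :: "('n, 'k::field) mpoly"
  shows "Poly_Mapping.lookup (f * monomial v) (u + v) = Poly_Mapping.lookup f u"
proof -
  have "f * monomial v = (\<Sum>w\<in>Poly_Mapping.keys f. Poly_Mapping.single w (Poly_Mapping.lookup f w)) * monomial v"
    using mpoly_eq_sum_single[of f] by simp
  also have "\<dots> = (\<Sum>w\<in>Poly_Mapping.keys f. Poly_Mapping.single (w + v) (Poly_Mapping.lookup f w))"
    by (simp add: sum_distrib_right monomial_def mult_single)
  finally have "Poly_Mapping.lookup (f * monomial v) (u + v) =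
     (\<Sum>w\<in>Poly_Mapping.keys f. if w = u then Poly_Mapping.lookup f u else 0)"
    by (simp add: lookup_sum lookup_single when_def)
  then show ?thesis by (simp add: in_keys_iff)
qed

lemma npow_irrelevant_degree:
  fixes v :: "'n::finite \<Rightarrow>\<^sub>0 nat"
  shows "v \<in> npow (upset (range unit_exp)) m \<Longrightarrow> m \<le> (\<Sum>k\<in>UNIV. Poly_Mapping.lookup v k)"
proof (induction m arbitrary: v)
  case (Suc m)
  then obtain u i w where v: "v = u + (unit_exp i + w)" "u \<in> npow (upset (range unit_exp)) m"
    by (auto simp: sumset_def upset_def)
  have "(\<Sum>k\<in>UNIV. Poly_Mapping.lookup (unit_exp i) k) = 1"
    unfolding lookup_unit_exp by simp
  then show ?case using Suc.IH[OF v(2)] unfolding v(1)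
    by (simp add: lookup_add sum.distrib)
qed simp

text \<open>
  It suffices to multiply by powers of single variables, because a monomial of large degree is
  divisible by a large power of some variable.
\<close>

lemma saturation_mono_span:
  fixes W :: "('n::finite \<Rightarrow>\<^sub>0 nat) set"
  assumes W: "up_closed W"
  shows "saturation (mono_span W) =
    (mono_span {u. \<forall>j. \<exists>s. u + nmul s (unit_exp j) \<in> W} :: ('n, 'k::field) mpoly set)"
proof (intro equalityI subsetI)
  define D where "D = upset (range (unit_exp :: 'n \<Rightarrow> _))"
  have mp: "ideal_power max_ideal i = (mono_span (npow D i) :: ('n, 'k) mpoly set)" for i
    unfolding max_ideal_eq D_def by (rule ideal_power_mono_span)
  fix f :: "('n, 'k) mpoly"
  {
    assume "f \<in> saturation (mono_span W)"
    then obtain i where i: "\<And>g. g \<in> mono_span (npow D i) \<Longrightarrow> f * g \<in> mono_span W"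
      by (auto simp: saturation_def colon_def mp)
    have "u + nmul i (unit_exp j) \<in> W" if u: "u \<in> Poly_Mapping.keys f" for u j
    proof -
      have "unit_exp j \<in> D" unfolding D_def by (rule subsetD[OF upset_superset rangeI])
      then have "nmul i (unit_exp j) \<in> npow D i" by (intro npow_nmul1) (auto simp: D_def)
      then have "f * monomial (nmul i (unit_exp j)) \<in> mono_span W" by (intro i) simp
      moreover have "u + nmul i (unit_exp j) \<in> Poly_Mapping.keys (f * monomial (nmul i (unit_exp j)))"
        using u lookup_mult_monomial[of f "nmul i (unit_exp j)" u] by (simp add: in_keys_iff)
      ultimately show ?thesis by (auto simp: mono_span_def)
    qed
    then show "f \<in> mono_span {u. \<forall>j. \<exists>s. u + nmul s (unit_exp j) \<in> W}"
      by (auto simp: mono_span_def)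
  next
    assume "f \<in> mono_span {u. \<forall>j. \<exists>s. u + nmul s (unit_exp j) \<in> W}"
    then have "\<forall>u\<in>Poly_Mapping.keys f. \<forall>j. \<exists>s. u + nmul s (unit_exp j) \<in> W"
      by (auto simp: mono_span_def)
    then obtain s where s: "\<And>u j. u \<in> Poly_Mapping.keys f \<Longrightarrow> u + nmul (s u j) (unit_exp j) \<in> W"
      by metis
    \<comment> \<open>a degree that forces, for each term of \<open>f\<close>, a large power of some variable\<close>
    define i where "i = Suc (\<Sum>u\<in>Poly_Mapping.keys f. \<Sum>j\<in>UNIV. s u j)"
    have "f * g \<in> mono_span W" if g: "g \<in> mono_span (npow D i)" for g
    proof -
      have "u + v \<in> W" if u: "u \<in> Poly_Mapping.keys f" and v: "v \<in> Poly_Mapping.keys g" for u v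
      proof -
        have "i \<le> (\<Sum>k\<in>UNIV. Poly_Mapping.lookup v k)"
          using npow_irrelevant_degree[of v i] g v by (auto simp: mono_span_def D_def)
        moreover have "(\<Sum>j\<in>UNIV. s u j) < i"
          unfolding i_def less_Suc_eq_le
          by (rule member_le_sum[of u "Poly_Mapping.keys f" "\<lambda>u. \<Sum>j\<in>UNIV. s u j"]) (use u in auto)
        ultimately obtain j where j: "s u j \<le> Poly_Mapping.lookup v j"
          by (metis (no_types, lifting) leD le_trans linear sum_mono)
        show ?thesis
        proof (rule up_closed_le[OF W s[OF u, of j]])
          fix k show "Poly_Mapping.lookup (u + nmul (s u j) (unit_exp j)) k \<le> Poly_Mapping.lookup (u + v) k"
            using j by (cases "j = k") (simp_all add: lookup_add lookup_single)
        qed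
      qed
      then show ?thesis using keys_mult[of f g] by (fastforce simp: mono_span_def)
    qed
    then show "f \<in> saturation (mono_span W)"
      unfolding saturation_def colon_def mp by (auto simp: i_def intro!: bexI[of _ i])
  }
qed

text \<open>
  The condition for \<open>j\<close> describes the \<open>n\<close>-th power of the ideal that arises from the generators with
  exponents in \<open>E\<close> by setting the variable \<open>j\<close> to 1: a product of \<open>n\<close> generators divides the monomial
  up to a power of this variable.
\<close>

definition sat_exps :: "('n \<Rightarrow>\<^sub>0 nat) set \<Rightarrow> nat \<Rightarrow> ('n \<Rightarrow>\<^sub>0 nat) set" where
  "sat_exps E n = {u. \<forall>j. \<exists>x. (\<Sum>g\<in>E. x g) = n \<and>
     (\<forall>k. k \<noteq> j \<longrightarrow> (\<Sum>g\<in>E. x g * Poly_Mapping.lookup g k) \<le> Poly_Mapping.lookup u k)}"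

lemma saturation_power_eq:
  fixes E :: "('n::finite \<Rightarrow>\<^sub>0 nat) set"
  assumes E: "finite E"
  shows "saturation (mono_span (npow (upset E) n)) = (mono_span (sat_exps E n) :: ('n, 'k::field) mpoly set)"
proof -
  have "(\<exists>s. u + nmul s (unit_exp j) \<in> npow (upset E) n) \<longleftrightarrow>
     (\<exists>x. (\<Sum>g\<in>E. x g) = n \<and>
     (\<forall>k. k \<noteq> j \<longrightarrow> (\<Sum>g\<in>E. x g * Poly_Mapping.lookup g k) \<le> Poly_Mapping.lookup u k))" for u j
  proof
    assume "\<exists>s. u + nmul s (unit_exp j) \<in> npow (upset E) n"
    then obtain s x where x: "(\<Sum>g\<in>E. x g) = n"
      "\<And>k. (\<Sum>g\<in>E. x g * Poly_Mapping.lookup g k) \<le> Poly_Mapping.lookup (u + nmul s (unit_exp j)) k"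
      unfolding npow_upset_iff[OF E] by blast
    have "(\<Sum>g\<in>E. x g * Poly_Mapping.lookup g k) \<le> Poly_Mapping.lookup u k" if "k \<noteq> j" for k
      using x(2)[of k] that by (simp add: lookup_add lookup_single when_def)
    with x(1) show "\<exists>x. (\<Sum>g\<in>E. x g) = n \<and>
     (\<forall>k. k \<noteq> j \<longrightarrow> (\<Sum>g\<in>E. x g * Poly_Mapping.lookup g k) \<le> Poly_Mapping.lookup u k)" by blast
  next
    assume "\<exists>x. (\<Sum>g\<in>E. x g) = n \<and>
     (\<forall>k. k \<noteq> j \<longrightarrow> (\<Sum>g\<in>E. x g * Poly_Mapping.lookup g k) \<le> Poly_Mapping.lookup u k)"
    then obtain x where x: "(\<Sum>g\<in>E. x g) = n"
      "\<And>k. k \<noteq> j \<Longrightarrow> (\<Sum>g\<in>E. x g * Poly_Mapping.lookup g k) \<le> Poly_Mapping.lookup u k" by blast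
    define s where "s = (\<Sum>g\<in>E. x g * Poly_Mapping.lookup g j)"
    have "(\<Sum>g\<in>E. x g * Poly_Mapping.lookup g k) \<le> Poly_Mapping.lookup (u + nmul s (unit_exp j)) k" for k
      using x(2)[of k] by (cases "k = j") (auto simp: s_def lookup_add lookup_single)
    with x(1) have "u + nmul s (unit_exp j) \<in> npow (upset E) n"
      unfolding npow_upset_iff[OF E] by blast
    then show "\<exists>s. u + nmul s (unit_exp j) \<in> npow (upset E) n" ..
  qed
  then show ?thesis by (simp add: saturation_mono_span sat_exps_def)
qed

lemma sat_exps_le:
  assumes "u \<in> sat_exps E n" "\<And>k. Poly_Mapping.lookup u k \<le> Poly_Mapping.lookup v k"
  shows "v \<in> sat_exps E n"
  using assms unfolding sat_exps_def by (auto) (meson le_trans)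

lemma up_closed_sat_exps: "up_closed (sat_exps E n)"
  unfolding up_closed_def using sat_exps_le[of _ E n] by (auto simp: lookup_add)

lemma sat_exps_0: "finite E \<Longrightarrow> sat_exps E 0 = UNIV"
  unfolding sat_exps_def by (auto intro!: exI[of _ "\<lambda>_. 0"])

lemma sat_exps_add:
  assumes "u \<in> sat_exps E m" "v \<in> sat_exps E n"
  shows "u + v \<in> sat_exps E (m + n)"
  unfolding sat_exps_def
proof (intro CollectI allI)
  fix j
  obtain x where x: "(\<Sum>g\<in>E. x g) = m"
      "\<And>k. k \<noteq> j \<Longrightarrow> (\<Sum>g\<in>E. x g * Poly_Mapping.lookup g k) \<le> Poly_Mapping.lookup u k"
    using assms(1) unfolding sat_exps_def by blast
  obtain y where y: "(\<Sum>g\<in>E. y g) = n"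
      "\<And>k. k \<noteq> j \<Longrightarrow> (\<Sum>g\<in>E. y g * Poly_Mapping.lookup g k) \<le> Poly_Mapping.lookup v k"
    using assms(2) unfolding sat_exps_def by blast
  show "\<exists>x. (\<Sum>g\<in>E. x g) = m + n \<and>
     (\<forall>k. k \<noteq> j \<longrightarrow> (\<Sum>g\<in>E. x g * Poly_Mapping.lookup g k) \<le> Poly_Mapping.lookup (u + v) k)"
    using x y by (intro exI[of _ "\<lambda>g. x g + y g"])
      (auto simp: sum.distrib add_mult_distrib lookup_add intro: add_mono)
qed

lemma npow_sat_exps:
  assumes "finite E"
  shows "npow (sat_exps E n) N \<subseteq> sat_exps E (n * N)"
proof (induction N)
  case 0
  then show ?case using sat_exps_0[OF assms] by simp
next
  case (Suc N)
  then show ?case using sat_exps_add[of _ E "n * N" _ n] by (auto simp: sumset_def add.commute)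
qed

section \<open>Counting minimal exponents of saturated powers\<close>

lemma minimal_imp_not_below:
  assumes "u \<in> U - nonminimal U" "Poly_Mapping.lookup u i > 0"
  shows "u - unit_exp i \<notin> U"
proof
  assume "u - unit_exp i \<in> U"
  then have "(u - unit_exp i) + unit_exp i \<in> nonminimal U" unfolding nonminimal_def by blast
  moreover have "unit_exp i + (u - unit_exp i) = u"
    using assms(2) by (intro pointwise_le_imp_add) (auto simp: lookup_single when_def)
  ultimately show False using assms(1) by (simp add: add.commute)
qed

lemma minimal_sat_exps_bounded:
  assumes E: "finite E" and G: "\<And>g k. g \<in> E \<Longrightarrow> Poly_Mapping.lookup g k \<le> G"
    and u: "u \<in> sat_exps E n - nonminimal (sat_exps E n)"
  shows "Poly_Mapping.lookup u k \<le> n * G"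
proof (rule ccontr)
  assume "\<not> ?thesis"
  then have gt: "n * G < Poly_Mapping.lookup u k" by simp
  have "u - unit_exp k \<in> sat_exps E n"
    unfolding sat_exps_def
  proof (intro CollectI allI)
    fix j
    obtain x where x: "(\<Sum>g\<in>E. x g) = n"
      "\<And>k. k \<noteq> j \<Longrightarrow> (\<Sum>g\<in>E. x g * Poly_Mapping.lookup g k) \<le> Poly_Mapping.lookup u k"
      using u unfolding sat_exps_def by blast
    have "(\<Sum>g\<in>E. x g * Poly_Mapping.lookup g k) \<le> n * G"
      unfolding x(1)[symmetric] sum_distrib_right by (intro sum_mono mult_le_mono2 G)
    then have "(\<Sum>g\<in>E. x g * Poly_Mapping.lookup g l) \<le> Poly_Mapping.lookup (u - unit_exp k) l" if "l \<noteq> j" for l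
      using x(2)[OF that] gt by (auto simp: lookup_minus lookup_single when_def)
    with x(1) show "\<exists>x. (\<Sum>g\<in>E. x g) = n \<and>
     (\<forall>l. l \<noteq> j \<longrightarrow> (\<Sum>g\<in>E. x g * Poly_Mapping.lookup g l) \<le> Poly_Mapping.lookup (u - unit_exp k) l)"
      by blast
  qed
  with minimal_imp_not_below[OF u, of k] gt show False by simp
qed

text \<open>
  The set \<open>F i j\<close> below collects the minimal exponents whose \<open>i\<close>-th coordinate cannot be lowered
  because of the condition for \<open>j\<close>. As this condition ignores the coordinate \<open>j\<close>, it follows that
  \<open>i \<noteq> j\<close>, and that the coordinates other than \<open>i\<close> and \<open>j\<close> determine first the coordinate \<open>i\<close> and
  then, by minimality, the coordinate \<open>j\<close>.
\<close>

lemma card_minimal_sat_exps: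
  fixes E :: "('n::finite \<Rightarrow>\<^sub>0 nat) set" and n :: nat
  assumes E: "finite E" and G: "\<And>g k. g \<in> E \<Longrightarrow> Poly_Mapping.lookup g k \<le> G"
  defines "S \<equiv> sat_exps E n - nonminimal (sat_exps E n)"
  shows "finite S" and "card S \<le> 1 + CARD('n)^2 * (n * G + 1) ^ (CARD('n) - 2)"
proof -
  define Q where "Q j u \<longleftrightarrow> (\<exists>x. (\<Sum>g\<in>E. x g) = n \<and>
     (\<forall>k. k \<noteq> j \<longrightarrow> (\<Sum>g\<in>E. x g * Poly_Mapping.lookup g k) \<le> Poly_Mapping.lookup u k))" for j u
  have sat: "u \<in> sat_exps E n \<longleftrightarrow> (\<forall>j. Q j u)" for u by (simp add: sat_exps_def Q_def)
  have Qmono: "Q j v" if Qu: "Q j u" and le: "\<And>k. k \<noteq> j \<Longrightarrow> Poly_Mapping.lookup u k \<le> Poly_Mapping.lookup v k" for j u v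
  proof -
    obtain x where x: "(\<Sum>g\<in>E. x g) = n"
      "\<And>k. k \<noteq> j \<Longrightarrow> (\<Sum>g\<in>E. x g * Poly_Mapping.lookup g k) \<le> Poly_Mapping.lookup u k"
      using Qu unfolding Q_def by blast
    have "(\<Sum>g\<in>E. x g * Poly_Mapping.lookup g k) \<le> Poly_Mapping.lookup v k" if "k \<noteq> j" for k
      using x(2)[OF that] le[OF that] by (rule le_trans)
    with x(1) show ?thesis unfolding Q_def by blast
  qed
  define F where "F i j = {u \<in> S. Poly_Mapping.lookup u i > 0 \<and> \<not> Q j (u - unit_exp i)}" for i j
  define P where "P = {p :: 'n \<times> 'n. fst p \<noteq> snd p}"
  have Fe: "F i j = {}" if "i = j" for i j
  proof -
    have "Q j (u - unit_exp i)" if "u \<in> S" for u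
      by (rule Qmono[of j u]) (use that \<open>i = j\<close> sat in \<open>auto simp: S_def lookup_minus lookup_single when_def\<close>)
    then show ?thesis by (auto simp: F_def)
  qed
  have cover: "S \<subseteq> {0} \<union> (\<Union>p\<in>P. F (fst p) (snd p))"
  proof
    fix u assume u: "u \<in> S"
    show "u \<in> {0} \<union> (\<Union>p\<in>P. F (fst p) (snd p))"
    proof (cases "u = 0")
      case False
      then obtain i where i: "Poly_Mapping.lookup u i > 0" by (rule exponent_neq_0_obtain)
      then have "u - unit_exp i \<notin> sat_exps E n" 
        using minimal_imp_not_below[of u "sat_exps E n" i] u by (simp add: S_def)
      then obtain j where "\<not> Q j (u - unit_exp i)" by (auto simp: sat)
      with u i have "u \<in> F i j" by (simp add: F_def)
      moreover from this Fe have "(i, j) \<in> P" by (auto simp: P_def)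
      ultimately show ?thesis by force
    qed simp
  qed
  have inj: "inj_on (\<lambda>u. restrict (Poly_Mapping.lookup u) (UNIV - {i, j})) (F i j)" for i j
  proof (rule inj_onI)
    fix u v assume u: "u \<in> F i j" and v: "v \<in> F i j"
      and "restrict (Poly_Mapping.lookup u) (UNIV - {i, j}) = restrict (Poly_Mapping.lookup v) (UNIV - {i, j})"
    then have eq: "Poly_Mapping.lookup u k = Poly_Mapping.lookup v k" if "k \<noteq> i" "k \<noteq> j" for k
      using that by (metis DiffI UNIV_I insertE restrict_apply' singletonD)
    have ij: "i \<noteq> j" using Fe u by blast
    have S: "u \<in> S" "v \<in> S" using u v by (auto simp: F_def)
    have no_i: False if "Poly_Mapping.lookup a i < Poly_Mapping.lookup b i"
      "\<And>k. k \<noteq> i \<Longrightarrow> k \<noteq> j \<Longrightarrow> Poly_Mapping.lookup a k = Poly_Mapping.lookup b k" "a \<in> F i j" "b \<in> F i j" for a b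
    proof -
      have "Q j a" using that(3) sat by (auto simp: F_def S_def)
      then have "Q j (b - unit_exp i)"
        by (rule Qmono) (use that(1,2) in \<open>auto simp: lookup_minus lookup_single when_def\<close>)
      then show False using that(4) by (simp add: F_def)
    qed
    have i: "Poly_Mapping.lookup u i = Poly_Mapping.lookup v i"
      using no_i[of u v] no_i[of v u] eq u v by (metis linorder_neqE_nat)
    have no_j: False if "Poly_Mapping.lookup a j < Poly_Mapping.lookup b j"
      "\<And>k. k \<noteq> j \<Longrightarrow> Poly_Mapping.lookup a k = Poly_Mapping.lookup b k" "a \<in> S" "b \<in> S" for a b
    proof -
      have "b - unit_exp j \<in> sat_exps E n"
        by (rule sat_exps_le[of a]) (use that in \<open>auto simp: S_def lookup_minus lookup_single when_def\<close>)
      then show False using minimal_imp_not_below[of b "sat_exps E n" j] that by (simp add: S_def)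
    qed
    have "Poly_Mapping.lookup u j = Poly_Mapping.lookup v j"
      using no_j[of u v] no_j[of v u] eq i S by (metis linorder_neqE_nat)
    then show "u = v" using eq i by (metis poly_mapping_eqI)
  qed
  have img: "(\<lambda>u. restrict (Poly_Mapping.lookup u) (UNIV - {i, j})) ` F i j \<subseteq> PiE (UNIV - {i, j}) (\<lambda>_. {..n * G})" for i j
    using minimal_sat_exps_bounded[OF E G] by (auto simp: F_def S_def PiE_def extensional_def split: if_splits)
  have finPi: "finite (PiE (UNIV - {i, j}) (\<lambda>_. {..n * G}))" for i j :: 'n
    by (intro finite_PiE) auto
  have finF: "finite (F i j)" for i j
    using inj img finPi by (rule inj_on_finite)
  have cardF: "card (F i j) \<le> (n * G + 1) ^ (CARD('n) - 2)" if "i \<noteq> j" for i j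
  proof -
    have "card (F i j) \<le> card (PiE (UNIV - {i, j}) (\<lambda>_. {..n * G}))"
      using inj img finPi by (rule card_inj_on_le)
    also have "\<dots> = (n * G + 1) ^ card (UNIV - {i, j})"
      by (subst card_PiE) (auto simp: prod_constant)
    also have "card (UNIV - {i, j}) = CARD('n) - 2"
      using that by (subst card_Diff_subset) (auto simp: card_insert_if)
    finally show ?thesis .
  qed
  have finP: "finite P" by simp
  have "finite (\<Union>p\<in>P. F (fst p) (snd p))" using finF by auto
  then show "finite S" using cover by (meson finite.emptyI finite.insertI finite_UnI finite_subset)
  have "card S \<le> card ({0} \<union> (\<Union>p\<in>P. F (fst p) (snd p)))"
    by (rule card_mono[OF _ cover]) (use finF in auto)
  also have "\<dots> \<le> card {0 :: 'n \<Rightarrow>\<^sub>0 nat} + card (\<Union>p\<in>P. F (fst p) (snd p))" by (rule card_Un_le)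
  also have "card (\<Union>p\<in>P. F (fst p) (snd p)) \<le> (\<Sum>p\<in>P. card (F (fst p) (snd p)))"
    by (rule card_UN_le[OF finP])
  also have "\<dots> \<le> (\<Sum>p\<in>P. (n * G + 1) ^ (CARD('n) - 2))"
    by (intro sum_mono cardF) (auto simp: P_def)
  also have "\<dots> = card P * (n * G + 1) ^ (CARD('n) - 2)" by simp
  also have "card P \<le> CARD('n \<times> 'n)" by (rule card_mono) auto
  also have "CARD('n \<times> 'n) = CARD('n)^2" by (simp add: power2_eq_square)
  finally show "card S \<le> 1 + CARD('n)^2 * (n * G + 1) ^ (CARD('n) - 2)" by simp
qed

section \<open>Integral closures of saturated powers\<close>

text \<open>
  Some multiple \<open>N u\<close> is bounded below, away from \<open>j\<close>, by a combination of \<open>n N\<close> generators. Dividing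
  the coefficients by \<open>N\<close> and rounding down loses less than one generator for each element of \<open>E\<close>.
\<close>

lemma approximate_combination:
  assumes E: "finite E" and u: "u \<in> newton_closure (sat_exps E n)"
  shows "\<exists>y. (\<Sum>g\<in>E. y g) \<le> n \<and> n \<le> (\<Sum>g\<in>E. y g) + card E \<and>
     (\<forall>k. k \<noteq> j \<longrightarrow> (\<Sum>g\<in>E. y g * Poly_Mapping.lookup g k) \<le> Poly_Mapping.lookup u k)"
proof -
  obtain N where N: "N \<ge> 1" "nmul N u \<in> npow (sat_exps E n) N" using u by (auto simp: newton_closure_def)
  then have "nmul N u \<in> sat_exps E (n * N)" using npow_sat_exps[OF E] by blast
  then obtain x where x: "(\<Sum>g\<in>E. x g) = n * N"
      "\<And>k. k \<noteq> j \<Longrightarrow> (\<Sum>g\<in>E. x g * Poly_Mapping.lookup g k) \<le> N * Poly_Mapping.lookup u k"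
    unfolding sat_exps_def by fastforce
  define y where "y g = x g div N" for g
  have le: "N * y g \<le> x g" for g by (simp add: y_def)
  have ge: "x g \<le> N * (y g + 1)" for g
  proof -
    have "x g = N * y g + x g mod N" by (simp add: y_def)
    moreover have "x g mod N < N" using N(1) by simp
    ultimately show ?thesis unfolding add_mult_distrib2 by linarith
  qed
  have "N * (\<Sum>g\<in>E. y g) \<le> N * n"
    using sum_mono[of E "\<lambda>g. N * y g" x] le x(1) by (simp add: sum_distrib_left mult.commute)
  moreover have "N * n \<le> N * ((\<Sum>g\<in>E. y g) + card E)"
  proof -
    have "N * n = (\<Sum>g\<in>E. x g)" using x(1) by (simp add: mult.commute)
    also have "\<dots> \<le> (\<Sum>g\<in>E. N * (y g + 1))" by (rule sum_mono[OF ge])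
    also have "\<dots> = N * ((\<Sum>g\<in>E. y g) + card E)" by (simp add: sum_distrib_left[symmetric] sum.distrib algebra_simps)
    finally show ?thesis .
  qed
  moreover have "N * (\<Sum>g\<in>E. y g * Poly_Mapping.lookup g k) \<le> N * Poly_Mapping.lookup u k" if "k \<noteq> j" for k
  proof -
    have "N * (\<Sum>g\<in>E. y g * Poly_Mapping.lookup g k) = (\<Sum>g\<in>E. (N * y g) * Poly_Mapping.lookup g k)"
      by (simp add: sum_distrib_left mult.assoc)
    also have "\<dots> \<le> (\<Sum>g\<in>E. x g * Poly_Mapping.lookup g k)" by (intro sum_mono mult_le_mono1 le)
    finally show ?thesis using x(2)[OF that] by (rule le_trans)
  qed
  ultimately show ?thesis using N(1) by (intro exI[of _ y]) auto
qed

text \<open>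
  Attach to every pair \<open>(u, n)\<close> and every \<open>j\<close> the rounded coefficients \<open>y\<close> of an approximate
  combination, the slack \<open>w\<close> in each coordinate and the number \<open>d\<close> of lost generators. If these data
  for two pairs are comparable and the numbers \<open>d\<close> agree, then the differences of the coefficients
  show that the difference of the pairs comes from a saturated power. Dickson's lemma provides
  finitely many pairs below all others.
\<close>

lemma newton_closure_sat_exps_finitely_generated:
  fixes E :: "('n::finite \<Rightarrow>\<^sub>0 nat) set"
  assumes E: "finite E" and r: "CARD('n) \<ge> 2"
  obtains H where "finite H" "\<And>u n. u \<in> newton_closure (sat_exps E n) \<Longrightarrow>
    \<exists>(h, m)\<in>H. m \<le> n \<and> h \<in> newton_closure (sat_exps E m) \<and> (\<exists>c\<in>sat_exps E (n - m). u = h + c)"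
proof -
  define Z where "Z = {z. fst z \<in> newton_closure (sat_exps E (snd z))}"
  define good where "good z j y \<longleftrightarrow> (\<Sum>g\<in>E. y g) \<le> snd z \<and> snd z \<le> (\<Sum>g\<in>E. y g) + card E \<and>
     (\<forall>k. k \<noteq> j \<longrightarrow> (\<Sum>g\<in>E. y g * Poly_Mapping.lookup g k) \<le> Poly_Mapping.lookup (fst z) k)"
    for z :: "('n \<Rightarrow>\<^sub>0 nat) \<times> nat" and j y
  define y where "y z j = (SOME y. good z j y)" for z j
  have "good z j (y z j)" if "z \<in> Z" for z j
  proof -
    have "\<exists>y. good z j y"
      using approximate_combination[OF E, of "fst z" "snd z" j] that unfolding Z_def good_def by simp
    then show ?thesis unfolding y_def by (rule someI_ex)
  qed
  then have y: "\<And>z j. z \<in> Z \<Longrightarrow> (\<Sum>g\<in>E. y z j g) \<le> snd z"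
    "\<And>z j. z \<in> Z \<Longrightarrow> snd z \<le> (\<Sum>g\<in>E. y z j g) + card E"
    "\<And>z j k. z \<in> Z \<Longrightarrow> k \<noteq> j \<Longrightarrow> (\<Sum>g\<in>E. y z j g * Poly_Mapping.lookup g k) \<le> Poly_Mapping.lookup (fst z) k"
    unfolding good_def by blast+
  define w where "w z j k = Poly_Mapping.lookup (fst z) k - (\<Sum>g\<in>E. y z j g * Poly_Mapping.lookup g k)" for z j k
  define d where "d z j = snd z - (\<Sum>g\<in>E. y z j g)" for z j
  \<comment> \<open>both \<open>d\<close> and \<open>card E - d\<close> are included, so that comparable data have the same \<open>d\<close>\<close>
  define Fs where "Fs = (\<lambda>(j, g) z. y z j g) ` (UNIV \<times> E) \<union> (\<lambda>(j, k) z. w z j k) ` UNIV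
     \<union> (\<lambda>j z. d z j) ` UNIV \<union> (\<lambda>j z. card E - d z j) ` UNIV"
  have finFs: "finite Fs" using E unfolding Fs_def by (intro finite_UnI finite_imageI) auto
  obtain H where H: "finite H" "H \<subseteq> Z" "\<And>z. z \<in> Z \<Longrightarrow> \<exists>h\<in>H. \<forall>f\<in>Fs. f h \<le> f z"
    using dickson_basis[OF finFs, of Z] by metis
  have "\<exists>(h, m)\<in>H. m \<le> n \<and> h \<in> newton_closure (sat_exps E m) \<and> (\<exists>c\<in>sat_exps E (n - m). u = h + c)"
    if u: "u \<in> newton_closure (sat_exps E n)" for u n
  proof -
    define z where "z = (u, n)"
    have z: "z \<in> Z" using u by (simp add: z_def Z_def)
    obtain h where h: "h \<in> H" "\<forall>f\<in>Fs. f h \<le> f z" using H(3)[OF z] by blast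
    have hZ: "h \<in> Z" using h(1) H(2) by blast
    have hy: "y h j g \<le> y z j g" if "g \<in> E" for j g
      using h(2) that unfolding Fs_def by fastforce
    have hw: "w h j k \<le> w z j k" for j k using h(2) unfolding Fs_def by fastforce
    have "d h j \<le> d z j" "card E - d h j \<le> card E - d z j" for j using h(2) unfolding Fs_def by auto
    moreover have "d h j \<le> card E" "d z j \<le> card E" for j
      using y(2)[OF hZ, of j] y(2)[OF z, of j] by (auto simp: d_def)
    ultimately have hd: "d h j = d z j" for j by (metis diff_diff_cancel diff_le_mono2 le_antisym)
    define x where "x j g = y z j g - y h j g" for j g
    have spl: "(\<Sum>g\<in>E. y z j g * c g) = (\<Sum>g\<in>E. y h j g * c g) + (\<Sum>g\<in>E. x j g * c g)" for j and c :: "_ \<Rightarrow> nat"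
      unfolding sum.distrib[symmetric] by (intro sum.cong) (auto simp: x_def hy add_mult_distrib[symmetric])
    have sx: "snd z = snd h + (\<Sum>g\<in>E. x j g)" for j
      using spl[of j "\<lambda>_. 1"] hd[of j] y(1)[OF z, of j] y(1)[OF hZ, of j] unfolding d_def by simp
    have ux: "Poly_Mapping.lookup (fst h) k + (\<Sum>g\<in>E. x j g * Poly_Mapping.lookup g k) \<le> Poly_Mapping.lookup (fst z) k"
      if "k \<noteq> j" for j k
      using spl[of j "\<lambda>g. Poly_Mapping.lookup g k"] hw[of j k] y(3)[OF z that] y(3)[OF hZ that]
      unfolding w_def by linarith
    \<comment> \<open>every coordinate is controlled by some \<open>j\<close> other than itself, as there are at least two variables\<close>
    have "\<exists>j. j \<noteq> k" for k :: 'n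
    proof (rule ccontr)
      assume "\<not> ?thesis"
      then have "(UNIV :: 'n set) = {k}" by auto
      then have "CARD('n) = 1" by (metis card.empty card_insert_disjoint empty_iff finite.emptyI One_nat_def)
      with r show False by simp
    qed
    then have le: "Poly_Mapping.lookup (fst h) k \<le> Poly_Mapping.lookup u k" for k
      using ux by (metis add_leD1 fst_conv z_def)
    have "u - fst h \<in> sat_exps E (n - snd h)"
      unfolding sat_exps_def
    proof (intro CollectI allI exI conjI impI)
      fix j show "(\<Sum>g\<in>E. x j g) = n - snd h" using sx[of j] by (simp add: z_def)
      fix k assume "k \<noteq> j"
      then show "(\<Sum>g\<in>E. x j g * Poly_Mapping.lookup g k) \<le> Poly_Mapping.lookup (u - fst h) k"
        using ux[of k j] by (simp add: z_def lookup_minus)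
    qed
    moreover have "u = fst h + (u - fst h)" using pointwise_le_imp_add[OF le] by simp
    moreover have "snd h \<le> n" using sx[of undefined] by (simp add: z_def)
    ultimately show ?thesis using h(1) hZ unfolding Z_def
      by (intro bexI[of _ h]) (auto simp: split_beta)
  qed
  then show ?thesis using that H(1) by blast
qed

lemma npow_sumset_subset:
  assumes "sumset U V \<subseteq> W" "u \<in> npow U N" "v \<in> npow V N"
  shows "u + v \<in> npow W N"
  using assms(2,3)
proof (induction N arbitrary: u v)
  case (Suc N)
  then obtain u1 u2 v1 v2 where *: "u = u1 + u2" "v = v1 + v2" "u1 \<in> npow U N" "u2 \<in> U"
    "v1 \<in> npow V N" "v2 \<in> V" by (auto simp: sumset_def)
  have "u + v = (u1 + v1) + (u2 + v2)" by (simp add: *(1,2) add_ac)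
  moreover have "u2 + v2 \<in> W" using assms(1) *(4,6) by (auto simp: sumset_def)
  moreover have "u1 + v1 \<in> npow W N" by (rule Suc.IH[OF *(3,5)])
  ultimately show ?case by (auto simp: sumset_def)
qed simp

lemma newton_closure_sat_exps_add:
  assumes "h \<in> newton_closure (sat_exps E m)" "c \<in> sat_exps E n"
  shows "h + c \<in> newton_closure (sat_exps E (m + n))"
proof -
  obtain N where N: "N \<ge> 1" "nmul N h \<in> npow (sat_exps E m) N" using assms(1) by (auto simp: newton_closure_def)
  have "nmul N c \<in> npow (sat_exps E n) N" by (rule npow_nmul1[OF up_closed_sat_exps assms(2)])
  then have "nmul N h + nmul N c \<in> npow (sat_exps E (m + n)) N"
    by (intro npow_sumset_subset[OF _ N(2)]) (auto simp: sumset_def intro: sat_exps_add)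
  then show ?thesis using N(1) unfolding newton_closure_def nmul_add_right[symmetric] by blast
qed

text \<open>
  If \<open>u = h + c\<close> is minimal in the closure, then \<open>c\<close> is minimal in its saturated power, because a
  smaller \<open>c\<close> would lead to a smaller element of the closure. So the number of minimal exponents is
  at most the sum of finitely many numbers bounded by \<open>card_minimal_sat_exps\<close>.
\<close>

lemma card_minimal_newton_closure_sat_exps:
  fixes E :: "('n::finite \<Rightarrow>\<^sub>0 nat) set"
  assumes E: "finite E" and r: "CARD('n) \<ge> 2"
  obtains K where "\<And>n. n \<ge> 1 \<Longrightarrow>
    finite (newton_closure (sat_exps E n) - nonminimal (newton_closure (sat_exps E n))) \<and>
    card (newton_closure (sat_exps E n) - nonminimal (newton_closure (sat_exps E n))) \<le> K * n ^ (CARD('n) - 2)"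
proof -
  obtain H where H: "finite H" "\<And>u n. u \<in> newton_closure (sat_exps E n) \<Longrightarrow>
    \<exists>(h, m)\<in>H. m \<le> n \<and> h \<in> newton_closure (sat_exps E m) \<and> (\<exists>c\<in>sat_exps E (n - m). u = h + c)"
    by (rule newton_closure_sat_exps_finitely_generated[OF E r]) blast
  define G where "G = (\<Sum>g\<in>E. \<Sum>k\<in>UNIV. Poly_Mapping.lookup g k)"
  have G: "Poly_Mapping.lookup g k \<le> G" if "g \<in> E" for g k
  proof -
    have "Poly_Mapping.lookup g k \<le> (\<Sum>k\<in>UNIV. Poly_Mapping.lookup g k)"
      by (rule member_le_sum) auto
    also have "\<dots> \<le> G" unfolding G_def by (rule member_le_sum[OF that]) (use E in auto)
    finally show ?thesis .
  qed
  define r where "r = CARD('n) - 2"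
  define S where "S n = sat_exps E n - nonminimal (sat_exps E n)" for n
  have S: "finite (S n)" "card (S n) \<le> 1 + CARD('n)^2 * (n * G + 1) ^ r" for n
    unfolding S_def r_def using card_minimal_sat_exps[OF E G] by blast+
  define A where "A n = newton_closure (sat_exps E n)" for n
  define K where "K = card H * (1 + CARD('n)^2 * (G + 1) ^ r)"
  have main: "finite (A n - nonminimal (A n)) \<and> card (A n - nonminimal (A n)) \<le> K * n ^ r" if n: "n \<ge> 1" for n
  proof -
    define H' where "H' = {p \<in> H. snd p \<le> n}"
    have finH': "finite H'" using H(1) by (simp add: H'_def)
    have cover: "A n - nonminimal (A n) \<subseteq> (\<Union>p\<in>H'. (+) (fst p) ` S (n - snd p))"
    proof
      fix u assume u: "u \<in> A n - nonminimal (A n)"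
      then obtain h m c where hmc: "(h, m) \<in> H" "m \<le> n" "h \<in> A m" "c \<in> sat_exps E (n - m)" "u = h + c"
        using H(2)[of u n] by (auto simp: A_def)
      have "c \<notin> nonminimal (sat_exps E (n - m))"
      proof
        assume "c \<in> nonminimal (sat_exps E (n - m))"
        then obtain c' i where c: "c = c' + unit_exp i" "c' \<in> sat_exps E (n - m)"
          by (auto simp: nonminimal_def)
        have "h + c' \<in> A n"
          using newton_closure_sat_exps_add[OF hmc(3)[unfolded A_def] c(2)] hmc(2) by (simp add: A_def)
        then have "(h + c') + unit_exp i \<in> nonminimal (A n)" by (auto simp: nonminimal_def)
        then show False using u by (simp add: hmc(5) c(1) add.assoc)
      qed
      then have "c \<in> S (n - m)" using hmc(4) by (simp add: S_def)
      then show "u \<in> (\<Union>p\<in>H'. (+) (fst p) ` S (n - snd p))"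
        using hmc(1,2,5) unfolding H'_def by force
    qed
    have fin: "finite (\<Union>p\<in>H'. (+) (fst p) ` S (n - snd p))" using finH' S(1) by auto
    have "card (A n - nonminimal (A n)) \<le> card (\<Union>p\<in>H'. (+) (fst p) ` S (n - snd p))"
      by (rule card_mono[OF fin cover])
    also have "\<dots> \<le> (\<Sum>p\<in>H'. card ((+) (fst p) ` S (n - snd p)))" by (rule card_UN_le[OF finH'])
    also have "\<dots> \<le> (\<Sum>p\<in>H'. (1 + CARD('n)^2 * (G + 1) ^ r) * n ^ r)"
    proof (rule sum_mono)
      fix p assume "p \<in> H'"
      have "card ((+) (fst p) ` S (n - snd p)) \<le> card (S (n - snd p))" by (rule card_image_le[OF S(1)])
      also have "\<dots> \<le> 1 + CARD('n)^2 * ((n - snd p) * G + 1) ^ r" by (rule S(2))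
      also have "\<dots> \<le> n ^ r + CARD('n)^2 * ((G + 1) ^ r * n ^ r)"
      proof (intro add_mono mult_le_mono2)
        show "1 \<le> n ^ r" using n by simp
        have "(n - snd p) * G + 1 \<le> (G + 1) * n" using n by (simp add: algebra_simps)
        then show "((n - snd p) * G + 1) ^ r \<le> (G + 1) ^ r * n ^ r"
          unfolding power_mult_distrib[symmetric] by (rule power_mono) simp
      qed
      also have "\<dots> = (1 + CARD('n)^2 * (G + 1) ^ r) * n ^ r" by (simp add: algebra_simps)
      finally show "card ((+) (fst p) ` S (n - snd p)) \<le> (1 + CARD('n)^2 * (G + 1) ^ r) * n ^ r" .
    qed
    also have "\<dots> = card H' * ((1 + CARD('n)^2 * (G + 1) ^ r) * n ^ r)" by simp
    also have "\<dots> \<le> card H * ((1 + CARD('n)^2 * (G + 1) ^ r) * n ^ r)"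
      by (intro mult_le_mono1 card_mono H(1)) (auto simp: H'_def)
    finally have "card (A n - nonminimal (A n)) \<le> K * n ^ r" unfolding K_def mult.assoc .
    with finite_subset[OF cover fin] show ?thesis by blast
  qed
  show ?thesis by (rule that[of K]) (use main in \<open>simp add: A_def r_def\<close>)
qed

section \<open>The case of one variable\<close>

definition no_const :: "('n, 'k::field) mpoly set" where
  "no_const = {f. Poly_Mapping.lookup f 0 = 0}"

lemma no_const_eq: "no_const = mono_span (- {0})"
  by (auto simp: no_const_def mono_span_def in_keys_iff)

lemma add_eq_0_exp: "u + v = 0 \<Longrightarrow> u = (0 :: 'n \<Rightarrow>\<^sub>0 nat)"
  by (rule poly_mapping_eqI) (metis add_is_0 lookup_add lookup_zero)

lemma lookup_mult_0:
  fixes f g :: "('n, 'k::field) mpoly"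
  shows "Poly_Mapping.lookup (f * g) 0 = Poly_Mapping.lookup f 0 * Poly_Mapping.lookup g 0"
proof -
  define c where "c = Poly_Mapping.lookup f 0"
  have "f - mconst c \<in> mono_span (- {0})"
    by (auto simp: mono_span_def in_keys_iff lookup_minus c_def mconst_def)
  moreover have "up_closed (- {0 :: 'n \<Rightarrow>\<^sub>0 nat})"
    using add_eq_0_exp by (auto simp: up_closed_def)
  ultimately have "g * (f - mconst c) \<in> mono_span (- {0})" by (intro mono_span_mult_left)
  then have "Poly_Mapping.lookup (g * (f - mconst c)) 0 = 0" by (auto simp: mono_span_def in_keys_iff)
  moreover have "f * g = mconst c * g + g * (f - mconst c)" by (simp add: algebra_simps)
  ultimately show ?thesis by (simp add: lookup_add c_def)
qed

lemma primeideal_no_const: "primeideal no_const (mpoly_ring :: ('n, 'k::field) mpoly ring)"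
proof (rule primeidealI)
  show "ideal no_const (mpoly_ring :: ('n, 'k::field) mpoly ring)"
    by (rule ideal_mpoly_ringI) (auto simp: no_const_def lookup_add lookup_mult_0)
  show "cring (mpoly_ring :: ('n, 'k::field) mpoly ring)" by (rule cring_mpoly_ring)
  have "1 \<notin> (no_const :: ('n, 'k::field) mpoly set)" by (simp add: no_const_def)
  then show "carrier mpoly_ring \<noteq> (no_const :: ('n, 'k::field) mpoly set)" by auto
qed (auto simp: no_const_def lookup_mult_0)

text \<open>
  The monomial with exponent \<open>v\<close> is annihilated modulo the ideal exactly by the polynomials without
  constant term.
\<close>

lemma associated_prime_of_socle_monomial:
  fixes W :: "('n \<Rightarrow>\<^sub>0 nat) set"
  assumes W: "up_closed W" and v: "v \<notin> W" and socle: "\<And>i. v + unit_exp i \<in> W"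
  shows "no_const \<in> associated_primes
    (quot_module (ideal_module UNIV) (mono_span W :: ('n, 'k::field) mpoly set))"
proof -
  let ?R = "mpoly_ring :: ('n, 'k) mpoly ring"
  let ?I = "mono_span W :: ('n, 'k) mpoly set"
  let ?U = "ideal_module (UNIV :: ('n, 'k) mpoly set)"
  let ?M = "quot_module ?U ?I"
  have iU: "ideal (UNIV :: ('n, 'k) mpoly set) ?R" by (rule ideal_mpoly_ringI) auto
  have mU: "module ?R ?U" by (rule module_ideal_module[OF iU])
  have sI: "submodule ?I ?R ?U" by (rule submodule_ideal_module[OF iU ideal_mono_span[OF W]]) simp
  define x where "x = ?I +>\<^bsub>?U\<^esub> monomial v"
  have "x \<in> carrier ?M" unfolding x_def carrier_quot_module by (rule imageI) simp
  moreover have "a \<odot>\<^bsub>?M\<^esub> x = \<zero>\<^bsub>?M\<^esub> \<longleftrightarrow> a \<in> no_const" for a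
  proof -
    have "a \<odot>\<^bsub>?M\<^esub> x = ?I +>\<^bsub>?U\<^esub> (a * monomial v)"
      using quot_module_smult[OF mU sI, of a "monomial v"] unfolding x_def by (simp del: quot_module_sel)
    then have "a \<odot>\<^bsub>?M\<^esub> x = \<zero>\<^bsub>?M\<^esub> \<longleftrightarrow> a * monomial v \<in> ?I"
      using quot_module_zero_iff[OF mU sI, of "a * monomial v"] by (simp del: quot_module_sel)
    also have "\<dots> \<longleftrightarrow> a \<in> no_const"
    proof
      assume "a * monomial v \<in> ?I"
      then have "Poly_Mapping.lookup (a * monomial v) (0 + v) = 0"
        using v by (auto simp: mono_span_def in_keys_iff)
      then show "a \<in> no_const" unfolding lookup_mult_monomial by (simp add: no_const_def)
    next
      assume "a \<in> no_const"
      then have "a * monomial v \<in> mono_span (sumset (- {0}) {v})"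
        unfolding no_const_eq by (rule mono_span_mult) simp
      moreover have "sumset (- {0}) {v} \<subseteq> W"
      proof
        fix z assume "z \<in> sumset (- {0}) {v}"
        then obtain u where u: "z = u + v" "u \<noteq> 0" by (auto simp: sumset_def)
        obtain i where i: "Poly_Mapping.lookup u i > 0" using u(2) by (rule exponent_neq_0_obtain)
        show "z \<in> W"
        proof (rule up_closed_le[OF W socle[of i]])
          fix k show "Poly_Mapping.lookup (v + unit_exp i) k \<le> Poly_Mapping.lookup z k"
            using i by (cases "k = i") (auto simp: u(1) lookup_add lookup_single)
        qed
      qed
      ultimately show "a * monomial v \<in> ?I" using mono_span_mono by blast
    qed
    finally show ?thesis .
  qed
  then have "no_const = {a. a \<odot>\<^bsub>?M\<^esub> x = \<zero>\<^bsub>?M\<^esub>}" by blast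
  ultimately show ?thesis using primeideal_no_const unfolding associated_primes_def by blast
qed

text \<open>
  The fractions with numerator in \<open>P\<close> and denominator outside of \<open>P\<close> form an ideal of the
  localization that contains the image of \<open>J\<close> but not 1.
\<close>

lemma one_notin_localized_ideal:
  fixes J :: "('n::{finite,linorder}, 'k::field) mpoly set"
  assumes P: "primeideal P mpoly_ring" and J: "J \<subseteq> P"
  shows "to_frac 1 \<notin> Idl\<^bsub>localization P\<^esub> (to_frac ` J)"
proof -
  interpret P: primeideal P mpoly_ring by (rule P)
  note Pid = ideal_mpoly_ringD[OF P.is_ideal]
  have P1: "1 \<notin> P" using P.one_imp_carrier P.I_notcarr by auto
  have Pmult: "s * t \<notin> P" if "s \<notin> P" "t \<notin> P" for s t using P.I_prime[of s t] that by auto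
  have P0: "s \<noteq> 0" if "s \<notin> P" for s using that Pid(1) by blast
  define L where "L = {Fract f s |f s. s \<notin> P}"
  define T where "T = {Fract f s |f s. f \<in> P \<and> s \<notin> P}"
  have loc: "localization P = ring_of_type_algebra\<lparr>carrier := L\<rparr>" by (simp add: localization_def L_def)
  let ?F = "ring_of_type_algebra :: ('n, 'k) mpoly fract ring"
  interpret F: cring ?F by (rule cring_from_type_algebra)
  have Fminus: "\<ominus>\<^bsub>?F\<^esub> x = - x" for x using F.minus_equality[of "- x" x] by simp
  have subL: "subring L ?F"
  proof (rule F.subringI)
    show "\<one>\<^bsub>?F\<^esub> \<in> L" using P1 unfolding L_def by (auto simp: One_fract_def)
    fix x y assume "x \<in> L" "y \<in> L"
    then obtain f s g t where *: "x = Fract f s" "y = Fract g t" "s \<notin> P" "t \<notin> P" unfolding L_def by blast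
    show "x \<otimes>\<^bsub>?F\<^esub> y \<in> L" using * Pmult unfolding L_def by auto
    show "x \<oplus>\<^bsub>?F\<^esub> y \<in> L" using * Pmult P0 unfolding L_def by auto
  next
    fix x assume "x \<in> L"
    then obtain f s where "x = Fract f s" "s \<notin> P" unfolding L_def by blast
    then have "- x = Fract (- f) s" "s \<notin> P" by simp_all
    then show "\<ominus>\<^bsub>?F\<^esub> x \<in> L" unfolding Fminus L_def by blast
  qed simp
  have ringL: "ring (localization P)" unfolding loc by (rule F.subring_is_ring[OF subL])
  have selL: "carrier (localization P) = L" "monoid.mult (localization P) = (*)"
    "ring.add (localization P) = (+)" "ring.zero (localization P) = 0"
    by (simp_all add: loc)
  have uminusT: "- x \<in> T" if xT: "x \<in> T" for x
  proof -
    obtain f s where "x = Fract f s" "f \<in> P" "s \<notin> P" using xT unfolding T_def by blast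
    then show ?thesis using Pid(3)[of f "- 1"] unfolding T_def by auto
  qed
  have mulT: "x * y \<in> T" if x: "x \<in> T" and y: "y \<in> L" for x y
  proof -
    obtain f s where "x = Fract f s" "f \<in> P" "s \<notin> P" using x unfolding T_def by blast
    moreover obtain g t where "y = Fract g t" "t \<notin> P" using y unfolding L_def by blast
    ultimately show ?thesis using Pmult Pid(3)[of f g] unfolding T_def by (auto simp: mult.commute)
  qed
  interpret LR: ring "localization P" by (rule ringL)
  have "ideal T (localization P)"
  proof (rule idealI[OF ringL])
    show "subgroup T (add_monoid (localization P))"
    proof (rule LR.add.subgroupI)
      show "T \<subseteq> carrier (localization P)" unfolding selL T_def L_def by blast
      have "Fract 0 1 \<in> T" using P1 Pid(1) unfolding T_def by blast
      then show "T \<noteq> {}" by blast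
      fix x assume x: "x \<in> T"
      have "x \<in> L" "- x \<in> L" using x uminusT[OF x] unfolding T_def L_def by blast+
      then have "\<ominus>\<^bsub>localization P\<^esub> x = - x" by (intro LR.minus_equality) (auto simp: selL)
      then show "\<ominus>\<^bsub>localization P\<^esub> x \<in> T" using uminusT[OF x] by simp
      fix y assume y: "y \<in> T"
      obtain f s where x: "x = Fract f s" "f \<in> P" "s \<notin> P" using x unfolding T_def by blast
      obtain g t where y: "y = Fract g t" "g \<in> P" "t \<notin> P" using y unfolding T_def by blast
      have "f * t + g * s \<in> P" using Pid(2,3) x(2) y(2) by (metis mult.commute)
      then show "x \<oplus>\<^bsub>localization P\<^esub> y \<in> T"
        using x y Pmult P0 unfolding T_def selL by auto
    qed
    fix x y assume "x \<in> T" "y \<in> carrier (localization P)"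
    then show "y \<otimes>\<^bsub>localization P\<^esub> x \<in> T" "x \<otimes>\<^bsub>localization P\<^esub> y \<in> T"
      using mulT[of x y] by (auto simp: selL mult.commute)
  qed
  moreover have "to_frac ` J \<subseteq> T" using J P1 unfolding to_frac_def T_def by blast
  ultimately have "Idl\<^bsub>localization P\<^esub> (to_frac ` J) \<subseteq> T" by (rule LR.genideal_minimal)
  moreover have "to_frac 1 \<notin> T"
  proof
    assume "to_frac 1 \<in> T"
    then obtain f s where fs: "Fract 1 1 = Fract f s" "f \<in> P" "s \<notin> P" unfolding T_def to_frac_def by blast
    then have "s = f" using P0[OF fs(3)] by (simp add: eq_fract)
    with fs show False by simp
  qed
  ultimately show ?thesis by blast
qed

text \<open>
  Let \<open>w\<close> be the least exponent in \<open>W\<close>. Its predecessor \<open>v\<close> is a socle monomial, so that 1 is not in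
  the symbolic power; but 1 is in the saturation, as \<open>w\<close> is a power of the only variable.
\<close>

lemma symbolic_power_ne_saturation_if_one_variable:
  fixes W :: "('n::{finite,linorder} \<Rightarrow>\<^sub>0 nat) set"
  assumes one: "CARD('n) = 1" and W: "up_closed W" "W \<noteq> {}" "0 \<notin> W"
  shows "symbolic_power (mono_span W) 1 \<noteq> saturation (ideal_power (mono_span W :: ('n, 'k::field) mpoly set) 1)"
proof -
  let ?I = "mono_span W :: ('n, 'k) mpoly set"
  obtain i0 where "(UNIV :: 'n set) = {i0}" using one by (metis card_1_singletonE)
  then have all: "k = i0" for k :: 'n by blast
  have pow: "ideal_power ?I 1 = ?I"
    unfolding ideal_power_mono_span One_nat_def npow_Suc_0[OF W(1)] ..
  obtain w where w: "w \<in> W" "\<And>u. u \<in> W \<Longrightarrow> Poly_Mapping.lookup w i0 \<le> Poly_Mapping.lookup u i0"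
    using ex_has_least_nat[of "\<lambda>u. u \<in> W" _ "\<lambda>u. Poly_Mapping.lookup u i0"] W(2) by blast
  have w0: "Poly_Mapping.lookup w i0 \<noteq> 0"
  proof
    assume "Poly_Mapping.lookup w i0 = 0"
    then have "w = 0" by (intro poly_mapping_eqI) (metis all lookup_zero)
    with w(1) W(3) show False by simp
  qed
  define v where "v = w - unit_exp i0"
  have "v \<notin> W" using w(2)[of v] w0 by (auto simp: v_def lookup_minus)
  moreover have "v + unit_exp i \<in> W" for i
  proof -
    have "v + unit_exp i = w"
    proof (rule poly_mapping_eqI)
      fix k
      have "i = i0" "k = i0" by (rule all)+
      then show "Poly_Mapping.lookup (v + unit_exp i) k = Poly_Mapping.lookup w k"
        using w0 by (simp add: v_def lookup_add lookup_minus)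
    qed
    with w(1) show ?thesis by simp
  qed
  ultimately have "no_const \<in> associated_primes (quot_module (ideal_module UNIV) ?I)"
    by (rule associated_prime_of_socle_monomial[OF W(1)])
  moreover have "to_frac 1 \<notin> Idl\<^bsub>localization no_const\<^esub> (to_frac ` ?I)"
    by (rule one_notin_localized_ideal[OF primeideal_no_const])
      (use W(3) in \<open>auto simp: no_const_eq mono_span_def\<close>)
  ultimately have "1 \<notin> symbolic_power ?I 1" unfolding symbolic_power_def pow by blast
  moreover have "1 \<in> saturation ?I"
  proof -
    have "\<exists>s. nmul s (unit_exp j) \<in> W" for j
    proof -
      have "nmul (Poly_Mapping.lookup w i0) (unit_exp j) = w"
        by (rule poly_mapping_eqI) (metis all lookup_nmul lookup_single_eq mult.right_neutral)
      with w(1) show ?thesis by metis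
    qed
    then show ?thesis unfolding saturation_mono_span[OF W(1)] by (simp add: mono_span_def)
  qed
  ultimately show ?thesis unfolding pow by metis
qed

section \<open>Bounds for the integral symbolic defect\<close>

lemma newton_closure_mono: "U \<subseteq> V \<Longrightarrow> newton_closure U \<subseteq> newton_closure V"
  using npow_mono unfolding newton_closure_def by blast

lemma npow_subset_sat_exps: "finite E \<Longrightarrow> npow (upset E) n \<subseteq> sat_exps E n"
  unfolding sat_exps_def using npow_upset_iff[of E _ n] by blast

lemma npow_UNIV: "npow UNIV n = UNIV"
proof (induction n)
  case (Suc n)
  have "u \<in> sumset UNIV UNIV" for u :: "'a \<Rightarrow>\<^sub>0 nat"
    unfolding sumset_def by (auto intro: exI[of _ u] exI[of _ 0])
  with Suc show ?case by auto
qed simp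

lemma monomial_ideal_finitely_generated:
  fixes I :: "('n::finite, 'k::field) mpoly set"
  assumes "monomial_ideal I"
  obtains E where "finite E" "I = mono_span (upset E)"
proof -
  obtain E0 :: "('n \<Rightarrow>\<^sub>0 nat) set" where "I = Idl\<^bsub>mpoly_ring\<^esub> (monomial ` E0)"
    using assms by (auto simp: monomial_ideal_def)
  then have "I = mono_span (upset E0)" by (simp only: genideal_monomials)
  moreover obtain E where "finite E" "upset E0 = upset E"
    by (rule upset_finite_basis_eq[of "upset E0"]) auto
  ultimately show ?thesis using that by simp
qed

lemma isdef_le_card:
  fixes I :: "('n::{finite, linorder}, 'k::field) mpoly set"
  assumes E: "finite E" and I: "I = mono_span (upset E)"
    and sym: "symbolic_power I n = saturation (ideal_power I n)"
  defines "U \<equiv> newton_closure (sat_exps E n)"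
  assumes fin: "finite (U - (nonminimal U \<union> newton_closure (npow (upset E) n)))"
  shows "isdef I n \<le> enat (card (U - (nonminimal U \<union> newton_closure (npow (upset E) n))))"
proof -
  have "isdef I n = num_gens (quot_module (ideal_module (mono_span U :: ('n, 'k) mpoly set))
      (mono_span (newton_closure (npow (upset E) n))))"
    unfolding isdef_def sym unfolding I ideal_power_mono_span saturation_power_eq[OF E] U_def
    by (simp add: integral_closure_mono_span up_closed_sat_exps)
  moreover have "newton_closure (npow (upset E) n) \<subseteq> U"
    unfolding U_def by (rule newton_closure_mono[OF npow_subset_sat_exps[OF E]])
  ultimately show ?thesis
    using num_gens_quot_le[OF _ _ _ fin, where ?'k = 'k]
    by (simp add: U_def up_closed_newton_closure up_closed_sat_exps)
qed

lemma isdef_polynomial_bound: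
  fixes I :: "('n::{finite, linorder}, 'k::field) mpoly set"
  assumes mon: "monomial_ideal I"
    and sym: "\<And>n. n \<ge> 1 \<Longrightarrow> symbolic_power I n = saturation (ideal_power I n)"
    and r: "CARD('n) \<ge> 2"
  shows "\<exists>K. \<forall>n\<ge>1. isdef I n \<le> enat (K * n ^ (CARD('n) - 2))"
proof -
  obtain E where E: "finite E" "I = mono_span (upset E)"
    by (rule monomial_ideal_finitely_generated[OF mon])
  define U where "U n = newton_closure (sat_exps E n)" for n
  obtain K where K: "\<And>n. n \<ge> 1 \<Longrightarrow> finite (U n - nonminimal (U n)) \<and>
      card (U n - nonminimal (U n)) \<le> K * n ^ (CARD('n) - 2)"
    using card_minimal_newton_closure_sat_exps[OF E(1) r] unfolding U_def by blast
  have "isdef I n \<le> enat (K * n ^ (CARD('n) - 2))" if n: "n \<ge> 1" for n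
  proof -
    let ?S = "U n - (nonminimal (U n) \<union> newton_closure (npow (upset E) n))"
    have fin: "finite ?S" by (rule finite_subset[of _ "U n - nonminimal (U n)"]) (use K[OF n] in auto)
    have "card ?S \<le> card (U n - nonminimal (U n))" by (rule card_mono) (use K[OF n] in auto)
    with K[OF n] have "enat (card ?S) \<le> enat (K * n ^ (CARD('n) - 2))" by simp
    with isdef_le_card[OF E sym[OF n] fin[unfolded U_def]] show ?thesis
      unfolding U_def by (rule order_trans)
  qed
  then show ?thesis by blast
qed

lemma isdef_eq_0_if_one_variable:
  fixes I :: "('n::{finite, linorder}, 'k::field) mpoly set"
  assumes mon: "monomial_ideal I"
    and sym: "\<And>n. n \<ge> 1 \<Longrightarrow> symbolic_power I n = saturation (ideal_power I n)"
    and one: "CARD('n) = 1" and n: "n \<ge> 1"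
  shows "isdef I n = 0"
proof -
  obtain E where E: "finite E" "I = mono_span (upset E)"
    by (rule monomial_ideal_finitely_generated[OF mon])
  have "upset E = {} \<or> 0 \<in> upset E"
    using symbolic_power_ne_saturation_if_one_variable[OF one, of "upset E", where ?'k = 'k] sym[of 1] E(2)
    by auto
  then have "newton_closure (sat_exps E n) \<subseteq> newton_closure (npow (upset E) n)"
  proof
    assume "upset E = {}"
    then have "E = {}" by (auto simp: upset_def)
    have "sat_exps E n = {}" using n unfolding sat_exps_def \<open>E = {}\<close> by auto
    moreover have "npow {} m = ({} :: ('n \<Rightarrow>\<^sub>0 nat) set)" if "m \<ge> 1" for m
      using that by (cases m) (auto simp: sumset_def)
    ultimately show ?thesis by (auto simp: newton_closure_def)
  next
    assume "0 \<in> upset E"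
    then have "upset E = UNIV" using up_closedD[OF up_closed_upset, of 0 E] by auto
    then show ?thesis by (auto simp: newton_closure_def npow_UNIV)
  qed
  then have e: "newton_closure (sat_exps E n) - (nonminimal (newton_closure (sat_exps E n)) \<union> newton_closure (npow (upset E) n)) = {}" by blast
  have "isdef I n \<le> enat 0"
    using isdef_le_card[OF E sym[OF n]] unfolding e by simp
  then show ?thesis by (simp add: zero_enat_def[symmetric])
qed

theorem theorem1p2:
  fixes I :: "('n::{finite, linorder}, 'k::field) mpoly set"
  assumes "monomial_ideal I"
    and "\<And>n. n \<ge> 1 \<Longrightarrow> symbolic_power I n = saturation (ideal_power I n)"
  shows "limsup (\<lambda>n. ereal_of_enat (isdef I n) / ereal (real n powi (int CARD('n) - 2))) < \<infinity>"
proof -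
  obtain K where K: "\<And>n. CARD('n) \<ge> 2 \<Longrightarrow> n \<ge> 1 \<Longrightarrow> isdef I n \<le> enat (K * n ^ (CARD('n) - 2))"
    using isdef_polynomial_bound[OF assms] by (cases "CARD('n) \<ge> 2") auto
  have "ereal_of_enat (isdef I n) / ereal (real n powi (int CARD('n) - 2)) \<le> ereal (real K)"
    if n: "n \<ge> 1" for n
  proof (cases "CARD('n) \<ge> 2")
    case True
    have le: "isdef I n \<le> enat (K * n ^ (CARD('n) - 2))" by (rule K[OF True n])
    then obtain d where d: "isdef I n = enat d" by (cases "isdef I n") auto
    have "int CARD('n) - 2 = int (CARD('n) - 2)" using True by simp
    then have p: "real n powi (int CARD('n) - 2) = real n ^ (CARD('n) - 2)"
      by (simp only: power_int_of_nat)
    have "d \<le> K * n ^ (CARD('n) - 2)" using le d by simp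
    then have "real d \<le> real (K * n ^ (CARD('n) - 2))" by (rule of_nat_mono)
    then have "real d / real n ^ (CARD('n) - 2) \<le> real K"
      using n by (simp add: divide_le_eq)
    then show ?thesis unfolding p d using n by simp
  next
    case False
    moreover have "CARD('n) \<noteq> 0" by simp
    ultimately have "CARD('n) = 1" by linarith
    then show ?thesis using isdef_eq_0_if_one_variable[OF assms _ n] by simp
  qed
  then have "eventually (\<lambda>n. ereal_of_enat (isdef I n) / ereal (real n powi (int CARD('n) - 2)) \<le> ereal (real K)) sequentially"
    unfolding eventually_sequentially by blast
  then have "limsup (\<lambda>n. ereal_of_enat (isdef I n) / ereal (real n powi (int CARD('n) - 2))) \<le> ereal (real K)"
    by (rule Limsup_bounded)
  then show ?thesis by (rule le_less_trans) simp
qed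

end
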